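(* Let $n\ge 1$, $T>0$, and let $u_0:\mathbf{R}^n\to\mathbf{R}$ be Lipschitz continuous. Let $H_1:\mathbf{R}^n\times[0,T]\times\mathbf{R}^n\to\mathbf{R}$ be continuous and such that: $H_1(x,t,\lambda p)=\lambda H_1(x,t,p)$ for all $\lambda>0$ and all $(x,t,p)$; there is $L_1>0$ with $|H_1(x,t,p)-H_1(y,t,p)|\le L_1|x-y|$ for all $x,y\in\mathbf{R}^n$, $t\in[0,T]$, $|p|=1$; there is $L_2>0$ with $|H_1(x,t,p)-H_1(x,t,q)|\le L_2|p-q|$ for all $x,p,q\in\mathbf{R}^n$, $t\in[0,T]$; and $\sup\{|H_1(x,t,p)| : x\in\mathbf{R}^n,\ t\in[0,T],\ |p|=1\}<\infty$. Let $\beta:\mathbf{R}\to\mathbf{R}$ be Lipschitz continuous, non-decreasing and bounded, with $\beta(0)=0$, $\beta(r)>0$ for $r>0$ and $\beta(r)<0$ for $r<0$. Let $h:\mathbf{R}^n\to\mathbf{R}$ satisfy $|h(p)-h(q)|\le\omega_h(|p-q|)$ for all $p,q\in\mathbf{R}^n$ for some modulus $\omega_h$, and assume $h(p)>0$ if $|p|<1$ and $h(p)=0$ if $|p|\ge 1$. Let $w$ be the viscosity solution of $w_t=H_1(x,t,\nabla w)$ in $\mathbf{R}^n\times(0,T)$, $w(\cdot,0)=u_0$, put $\Gamma_t=\{x: w(x,t)=0\}$, $D^{\pm}_t=\{x:\pm w(x,t)>0\}$, and assume $\Gamma_t\ne\emptyset$ for all $t\in[0,T)$. Let $d(x,t)=\mathrm{dist}(x,\Gamma_t)$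 if $x\in D^+_t\cup\Gamma_t$ and $d(x,t)=-\mathrm{dist}(x,\Gamma_t)$ if $x\in D^-_t$. For $\theta>0$ let $u^\theta$ be the viscosity solution of $$u^\theta_t=H_1(x,t,\nabla u^\theta)+\theta\,\beta(u^\theta)\,h(\nabla u^\theta)\ \text{ in }\mathbf{R}^n\times(0,T),\qquad u^\theta(\cdot,0)=u_0.$$ Then, for every $t\in(0,T)$, $$d(x,t)\le\sup_{\theta>0}u^\theta(x,t)<+\infty\quad\text{for all }x\in D^+_t,$$ $$d(x,t)\ge\inf_{\theta>0}u^\theta(x,t)>-\infty\quad\text{for all }x\in D^-_t.$$
   Context: A modulus is a non-decreasing function $\omega:[0,\infty)\to[0,\infty)$ with $\omega(0)=0=\lim_{r\to0}\omega(r)$. $\mathrm{dist}(x,\Omega)=\inf_{y\in\Omega}|x-y|$. Viscosity solutions of $u_t=F(x,t,u,\nabla u)$ with $F$ continuous: $u$ is a subsolution if $\phi_t\le F(x_0,t_0,\phi,\nabla\phi)$ at $(x_0,t_0)$ whenever $\phi\in C^1$ touches the upper semicontinuous envelope $u^*$ from above at $(x_0,t_0)\in\mathbf{R}^n\times(0,T)$; a supersolution if $\phi_t\ge F$ whenever $\phi$ touches the lower semicontinuous envelope $u_*$ from below; a solution if both. "The viscosity solution" of an initial value problem here means the unique solution that is continuous on $\mathbf{R}^n\times[0,T)$, attains the initial datum, and satisfies $u_0(x)-Kt\le u(x,t)\le u_0(x)+Kt$ for some $K>0$ (depending on $\theta$). *)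

theory Defs
  imports "HOL-Analysis.Analysis"
begin

text \<open>Only the values of \<open>\<omega>\<close> on \<open>[0, \<infinity>)\<close> matter.\<close>

definition modulus :: "(real \<Rightarrow> real) \<Rightarrow> bool" where
  "modulus \<omega> \<longleftrightarrow>
     mono_on {0..} \<omega> \<and> (\<forall>r\<ge>0. 0 \<le> \<omega> r) \<and> \<omega> 0 = 0 \<and> (\<omega> \<longlongrightarrow> 0) (at_right 0)"


text \<open>A function \<open>u\<close> of \<open>(x, t)\<close> is meaningful only for \<open>t \<in> [0, T)\<close>; what it does
  elsewhere is irrelevant to all notions below.\<close>

definition cylinder :: "real \<Rightarrow> ('a::euclidean_space \<times> real) set" where
  "cylinder T = UNIV \<times> {0<..<T}"

text \<open>Filters \<open>nhds z\<close> contain the point \<open>z\<close> itself, so these are the usual envelopes and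
  not the limits over punctured neighbourhoods.\<close>

definition usc_envelope ::
  "('b::topological_space) set \<Rightarrow> ('b \<Rightarrow> real) \<Rightarrow> 'b \<Rightarrow> ereal" where
  "usc_envelope Q u z = Limsup (inf (nhds z) (principal Q)) (\<lambda>y. ereal (u y))"

definition lsc_envelope ::
  "('b::topological_space) set \<Rightarrow> ('b \<Rightarrow> real) \<Rightarrow> 'b \<Rightarrow> ereal" where
  "lsc_envelope Q u z = Liminf (inf (nhds z) (principal Q)) (\<lambda>y. ereal (u y))"

text \<open>The function \<open>\<phi>\<close> is \<open>C\<^sup>1\<close> on the open set \<open>Q\<close> with gradient \<open>G\<close>. On
  \<open>Q = cylinder T\<close> one has \<open>G z = (\<nabla>\<phi> z, \<phi>\<^sub>t z)\<close>, because the inner product of the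
  product space is the sum of the inner products of the components.\<close>

definition C1_with_gradient ::
  "('b::real_inner) set \<Rightarrow> ('b \<Rightarrow> real) \<Rightarrow> ('b \<Rightarrow> 'b) \<Rightarrow> bool" where
  "C1_with_gradient Q \<phi> G \<longleftrightarrow> (\<forall>z\<in>Q. GDERIV \<phi> z :> G z) \<and> continuous_on Q G"

definition touches_from_above ::
  "('b::topological_space \<Rightarrow> real) \<Rightarrow> ('b \<Rightarrow> ereal) \<Rightarrow> 'b \<Rightarrow> bool" where
  "touches_from_above \<phi> v z \<longleftrightarrow> v z = ereal (\<phi> z) \<and> (\<forall>\<^sub>F y in nhds z. v y \<le> ereal (\<phi> y))"

definition touches_from_below ::
  "('b::topological_space \<Rightarrow> real) \<Rightarrow> ('b \<Rightarrow> ereal) \<Rightarrow> 'b \<Rightarrow> bool" where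
  "touches_from_below \<phi> v z \<longleftrightarrow> v z = ereal (\<phi> z) \<and> (\<forall>\<^sub>F y in nhds z. ereal (\<phi> y) \<le> v y)"

text \<open>Viscosity notions for \<open>u\<^sub>t = F(x, t, u, \<nabla>u)\<close> in \<open>cylinder T\<close>.\<close>

definition viscosity_subsolution ::
  "real \<Rightarrow> ('a::euclidean_space \<Rightarrow> real \<Rightarrow> real \<Rightarrow> 'a \<Rightarrow> real) \<Rightarrow> ('a \<Rightarrow> real \<Rightarrow> real) \<Rightarrow> bool" where
  "viscosity_subsolution T F u \<longleftrightarrow>
     (\<forall>\<phi> G. C1_with_gradient (cylinder T) \<phi> G \<longrightarrow>
       (\<forall>(x, t) \<in> cylinder T.
          touches_from_above \<phi> (usc_envelope (cylinder T) (\<lambda>(y, s). u y s)) (x, t) \<longrightarrow>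
          snd (G (x, t)) \<le> F x t (\<phi> (x, t)) (fst (G (x, t)))))"

definition viscosity_supersolution ::
  "real \<Rightarrow> ('a::euclidean_space \<Rightarrow> real \<Rightarrow> real \<Rightarrow> 'a \<Rightarrow> real) \<Rightarrow> ('a \<Rightarrow> real \<Rightarrow> real) \<Rightarrow> bool" where
  "viscosity_supersolution T F u \<longleftrightarrow>
     (\<forall>\<phi> G. C1_with_gradient (cylinder T) \<phi> G \<longrightarrow>
       (\<forall>(x, t) \<in> cylinder T.
          touches_from_below \<phi> (lsc_envelope (cylinder T) (\<lambda>(y, s). u y s)) (x, t) \<longrightarrow>
          snd (G (x, t)) \<ge> F x t (\<phi> (x, t)) (fst (G (x, t)))))"

definition viscosity_solution ::
  "real \<Rightarrow> ('a::euclidean_space \<Rightarrow> real \<Rightarrow> real \<Rightarrow> 'a \<Rightarrow> real) \<Rightarrow> ('a \<Rightarrow> real \<Rightarrow> real) \<Rightarrow> bool" where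
  "viscosity_solution T F u \<longleftrightarrow> viscosity_subsolution T F u \<and> viscosity_supersolution T F u"

text \<open>The class of solutions of the initial value problem that is singled out by continuity
  up to \<open>t = 0\<close> and the linear-in-time bound. Uniqueness within this class is a consequence
  of the comparison principle and is not part of the definition.\<close>

definition viscosity_solution_ivp ::
  "real \<Rightarrow> ('a::euclidean_space \<Rightarrow> real \<Rightarrow> real \<Rightarrow> 'a \<Rightarrow> real) \<Rightarrow> ('a \<Rightarrow> real) \<Rightarrow>
   ('a \<Rightarrow> real \<Rightarrow> real) \<Rightarrow> bool" where
  "viscosity_solution_ivp T F u0 u \<longleftrightarrow>
     viscosity_solution T F u \<and>
     continuous_on (UNIV \<times> {0..<T}) (\<lambda>(x, t). u x t) \<and>
     (\<forall>x. u x 0 = u0 x) \<and>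
     (\<exists>K>0. \<forall>x. \<forall>t\<in>{0..<T}. u0 x - K * t \<le> u x t \<and> u x t \<le> u0 x + K * t)"


definition zero_level :: "('a \<Rightarrow> real \<Rightarrow> real) \<Rightarrow> real \<Rightarrow> 'a set" where
  "zero_level w t = {x. w x t = 0}"

definition pos_region :: "('a \<Rightarrow> real \<Rightarrow> real) \<Rightarrow> real \<Rightarrow> 'a set" where
  "pos_region w t = {x. w x t > 0}"

definition neg_region :: "('a \<Rightarrow> real \<Rightarrow> real) \<Rightarrow> real \<Rightarrow> 'a set" where
  "neg_region w t = {x. - w x t > 0}"

text \<open>Pitfall: \<open>infdist x {} = 0\<close>, so this is the signed distance only when the zero level
  is nonempty.\<close>

definition signed_distance :: "('a::metric_space \<Rightarrow> real \<Rightarrow> real) \<Rightarrow> 'a \<Rightarrow> real \<Rightarrow> real" where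
  "signed_distance w x t =
     (if x \<in> pos_region w t \<union> zero_level w t then infdist x (zero_level w t)
      else - infdist x (zero_level w t))"

end

theory Submission
  imports Defs
begin

text \<open>
  The reaction \<open>\<theta> \<beta>(u) h(\<nabla>u)\<close> vanishes where \<open>|\<nabla>u| \<ge> 1\<close> and is at most linear in \<open>u\<close>, while the
  equation for \<open>w\<close> is invariant under increasing changes of the dependent variable. Hence, with
  \<open>K\<close> depending on \<open>\<theta>\<close>, a smooth version of \<open>max w (e\<^sup>K\<^sup>t w)\<close> is a supersolution of the equation for
  \<open>u\<^sup>\<theta>\<close>, so that \<open>u\<^sup>\<theta> \<le> max w (e\<^sup>K\<^sup>t w)\<close>, and by reflection \<open>u\<^sup>\<theta> \<ge> w\<close> where \<open>w \<ge> 0\<close>.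

  Finiteness: doubling the variables with the cone \<open>M e\<^sup>L\<^sup>t |x - y|\<close>, \<open>M \<ge> 2\<close>, involves only gradients
  that switch off the reaction, provided that the maximum is not on the diagonal, which is what the
  first comparison excludes. This gives \<open>u\<^sup>\<theta>(x, t) \<le> M e\<^sup>L\<^sup>t |x - y|\<close> for all \<open>y\<close> with \<open>w(y, t) = 0\<close>,
  independently of \<open>\<theta>\<close>.

  Lower bound: on a closed ball of radius \<open>\<rho> < dist(x, \<Gamma>\<^sub>t)\<close> around \<open>x\<close> one has \<open>u\<^sup>\<theta> \<ge> w \<ge> \<eta> > 0\<close> near
  time \<open>t\<close>. A rounded cone of slope \<open>c < 1\<close> that vanishes on the boundary of the ball cannot touch
  \<open>u\<^sup>\<theta>\<close> from below inside when \<open>\<theta>\<close> is large, as there \<open>\<theta> \<beta>(\<eta>) h\<close> dominates all other terms.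

  The negative region follows by reflecting all data.
\<close>

subsection \<open>Viscosity subsolutions\<close>

text \<open>Only used for continuous \<open>u\<close>. Supersolutions \<open>v\<close> of \<open>v\<^sub>t = F(x, t, v, \<nabla>v)\<close> are expressed through
  the subsolution \<open>- v\<close> of the equation with right-hand side \<open>- F(x, t, - r, - p)\<close>.\<close>

definition csub :: "real \<Rightarrow> ('a::euclidean_space \<Rightarrow> real \<Rightarrow> real \<Rightarrow> 'a \<Rightarrow> real) \<Rightarrow> ('a \<Rightarrow> real \<Rightarrow> real) \<Rightarrow> bool" where
  "csub T F u \<longleftrightarrow>
     (\<forall>\<phi> G x t. C1_with_gradient (cylinder T) \<phi> G \<longrightarrow> 0 < t \<longrightarrow> t < T \<longrightarrow> u x t = \<phi> (x, t) \<longrightarrow>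
        (\<forall>\<^sub>F z in nhds (x, t). u (fst z) (snd z) \<le> \<phi> z) \<longrightarrow>
        snd (G (x, t)) \<le> F x t (\<phi> (x, t)) (fst (G (x, t))))"

section \<open>Envelopes of continuous functions\<close>

lemma open_cylinder: "open (cylinder T)"
  unfolding cylinder_def by (intro open_Times) auto

lemma inf_nhds_principal_open:
  assumes "open Q" "z \<in> Q"
  shows "inf (nhds z) (principal Q) = nhds z"
  by (metis assms eventually_nhds_in_open inf.absorb1 le_principal)

lemma envelope_eq:
  fixes f :: "'b::t2_space \<Rightarrow> real"
  assumes "open Q" "z \<in> Q" "continuous_on Q f"
  shows "usc_envelope Q f z = ereal (f z)" "lsc_envelope Q f z = ereal (f z)"
proof -
  have "isCont f z"
    using assms continuous_on_eq_continuous_at by blast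
  then have "(f \<longlongrightarrow> f z) (nhds z)"
    by (simp add: isCont_def tendsto_at_iff_tendsto_nhds)
  then have *: "((\<lambda>y. ereal (f y)) \<longlongrightarrow> ereal (f z)) (nhds z)" by simp
  show "usc_envelope Q f z = ereal (f z)"
    unfolding usc_envelope_def inf_nhds_principal_open[OF assms(1,2)]
    by (rule lim_imp_Limsup[OF _ *]) simp
  show "lsc_envelope Q f z = ereal (f z)"
    unfolding lsc_envelope_def inf_nhds_principal_open[OF assms(1,2)]
    by (rule lim_imp_Liminf[OF _ *]) simp
qed

text \<open>On the open cylinder a continuous function coincides with its envelopes, so touching the
  envelope and touching \<open>u\<close> are the same condition.\<close>

lemma csub_of_viscosity_subsolution:
  assumes "viscosity_subsolution T F u" "continuous_on (UNIV \<times> {0..<T}) (\<lambda>(x, t). u x t)"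
  shows "csub T F u"
  unfolding csub_def
proof (intro allI impI)
  fix \<phi> G x t
  assume C1: "C1_with_gradient (cylinder T) \<phi> G" and t: "0 < t" "t < T"
    and eq: "u x t = \<phi> (x, t)"
    and ev: "\<forall>\<^sub>F z in nhds (x, t). u (fst z) (snd z) \<le> \<phi> z"
  have mem: "(x, t) \<in> cylinder T" using t by (auto simp: cylinder_def)
  have cont: "continuous_on (cylinder T) (\<lambda>(x, t). u x t)"
    by (rule continuous_on_subset[OF assms(2)]) (auto simp: cylinder_def)
  have env: "usc_envelope (cylinder T) (\<lambda>(y, s). u y s) z = ereal (u (fst z) (snd z))"
    if "z \<in> cylinder T" for z
    using envelope_eq(1)[OF open_cylinder that cont] by (simp add: case_prod_beta)
  have "\<forall>\<^sub>F z in nhds (x, t). z \<in> cylinder T"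
    by (rule eventually_nhds_in_open[OF open_cylinder mem])
  with ev have "\<forall>\<^sub>F z in nhds (x, t). usc_envelope (cylinder T) (\<lambda>(y, s). u y s) z \<le> ereal (\<phi> z)"
    by eventually_elim (simp add: env)
  then have "touches_from_above \<phi> (usc_envelope (cylinder T) (\<lambda>(y, s). u y s)) (x, t)"
    using env[OF mem] eq by (simp add: touches_from_above_def)
  then show "snd (G (x, t)) \<le> F x t (\<phi> (x, t)) (fst (G (x, t)))"
    using assms(1) C1 mem unfolding viscosity_subsolution_def by blast
qed

lemma C1_with_gradient_uminus:
  assumes "C1_with_gradient Q \<phi> G"
  shows "C1_with_gradient Q (\<lambda>z. - \<phi> z) (\<lambda>z. - G z)"
  using assms unfolding C1_with_gradient_def
  by (auto intro!: GDERIV_minus continuous_intros)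

text \<open>If \<open>\<phi>\<close> touches \<open>- u\<close> from above, then
  \<open>- \<phi>\<close> touches \<open>u\<close> from below. The sign passes to value, gradient
  and time derivative, which produces the reflected right-hand side.\<close>

lemma csub_of_viscosity_supersolution:
  assumes "viscosity_supersolution T F u" "continuous_on (UNIV \<times> {0..<T}) (\<lambda>(x, t). u x t)"
  shows "csub T (\<lambda>x t r p. - F x t (- r) (- p)) (\<lambda>x t. - u x t)"
  unfolding csub_def
proof (intro allI impI)
  fix \<phi> G x t
  assume C1: "C1_with_gradient (cylinder T) \<phi> G" and t: "0 < t" "t < T"
    and eq: "- u x t = \<phi> (x, t)"
    and ev: "\<forall>\<^sub>F z in nhds (x, t). - u (fst z) (snd z) \<le> \<phi> z"
  have mem: "(x, t) \<in> cylinder T" using t by (auto simp: cylinder_def)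
  have cont: "continuous_on (cylinder T) (\<lambda>(x, t). u x t)"
    by (rule continuous_on_subset[OF assms(2)]) (auto simp: cylinder_def)
  have env: "lsc_envelope (cylinder T) (\<lambda>(y, s). u y s) z = ereal (u (fst z) (snd z))"
    if "z \<in> cylinder T" for z
    using envelope_eq(2)[OF open_cylinder that cont] by (simp add: case_prod_beta)
  have "\<forall>\<^sub>F z in nhds (x, t). z \<in> cylinder T"
    by (rule eventually_nhds_in_open[OF open_cylinder mem])
  with ev have "\<forall>\<^sub>F z in nhds (x, t). ereal (- \<phi> z) \<le> lsc_envelope (cylinder T) (\<lambda>(y, s). u y s) z"
    by eventually_elim (simp add: env)
  then have "touches_from_below (\<lambda>z. - \<phi> z) (lsc_envelope (cylinder T) (\<lambda>(y, s). u y s)) (x, t)"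
    using env[OF mem] eq by (simp add: touches_from_below_def)
  then have "snd (- G (x, t)) \<ge> F x t (- \<phi> (x, t)) (fst (- G (x, t)))"
    using assms(1) C1_with_gradient_uminus[OF C1] mem
    unfolding viscosity_supersolution_def by blast
  then show "snd (G (x, t)) \<le> - F x t (- \<phi> (x, t)) (- fst (G (x, t)))" by simp
qed

section \<open>Change of the unknown in a subsolution\<close>

lemma csub_mono:
  assumes "csub T F u" "\<And>x t r p. 0 < t \<Longrightarrow> t < T \<Longrightarrow> F x t r p \<le> F' x t r p"
  shows "csub T F' u"
  using assms unfolding csub_def by (meson order_trans)

text \<open>Here \<open>g\<close> is the inverse change of the unknown, leading from
  \<open>U\<close> back to \<open>u\<close>. Being monotone in its first argument, it carries a test
  function \<open>\<phi>\<close> for \<open>U\<close> to the test function \<open>g \<phi>\<close>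
  for \<open>u\<close>. By the chain rule the new gradient is \<open>gz\<close> times the old one,
  and the new time derivative has the extra term \<open>gt\<close>. Dividing by \<open>gz\<close>
  gives the claim.\<close>

lemma csub_transform:
  fixes g gz gt :: "real \<Rightarrow> real \<Rightarrow> real"
  assumes u: "csub T F u"
    and deriv: "\<And>z t. 0 < t \<Longrightarrow> t < T \<Longrightarrow> GDERIV (\<lambda>(z, t). g z t) (z, t) :> (gz z t, gt z t)"
    and cont: "continuous_on (UNIV \<times> {0<..<T}) (\<lambda>(z, t). gz z t)"
      "continuous_on (UNIV \<times> {0<..<T}) (\<lambda>(z, t). gt z t)"
    and mono: "\<And>t. 0 < t \<Longrightarrow> t < T \<Longrightarrow> mono (\<lambda>z. g z t)"
    and pos: "\<And>z t. 0 < t \<Longrightarrow> t < T \<Longrightarrow> 0 < gz z t"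
    and inv: "\<And>x t. 0 < t \<Longrightarrow> t < T \<Longrightarrow> g (U x t) t = u x t"
    and F: "\<And>x t r p. 0 < t \<Longrightarrow> t < T \<Longrightarrow>
      F x t (g r t) (gz r t *\<^sub>R p) \<le> gt r t + gz r t * F' x t r p"
  shows "csub T F' U"
  unfolding csub_def
proof (intro allI impI)
  fix \<phi> G x t
  assume C1: "C1_with_gradient (cylinder T) \<phi> G" and t: "0 < t" "t < T"
    and eq: "U x t = \<phi> (x, t)"
    and ev: "\<forall>\<^sub>F z in nhds (x, t). U (fst z) (snd z) \<le> \<phi> z"
  have mem: "(x, t) \<in> cylinder T" using t by (auto simp: cylinder_def)
  define \<psi> where "\<psi> z = g (\<phi> z) (snd z)" for z
  define H where "H z = (gz (\<phi> z) (snd z) *\<^sub>R fst (G z),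
      gz (\<phi> z) (snd z) * snd (G z) + gt (\<phi> z) (snd z))" for z
  have \<phi>cont: "continuous_on (cylinder T) \<phi>"
    using C1 unfolding C1_with_gradient_def gderiv_def
    by (meson continuous_at_imp_continuous_on has_derivative_continuous)
  have C1': "C1_with_gradient (cylinder T) \<psi> H"
    unfolding C1_with_gradient_def
  proof (intro conjI ballI)
    fix z :: "'a \<times> real" assume z: "z \<in> cylinder T"
    then have s: "0 < snd z" "snd z < T" by (auto simp: cylinder_def)
    have d1: "(\<phi> has_derivative (\<lambda>h. inner h (G z))) (at z)"
      using C1 z by (simp add: C1_with_gradient_def gderiv_def)
    have d2: "((\<lambda>z. (\<phi> z, snd z)) has_derivative (\<lambda>h. (inner h (G z), snd h))) (at z)"
      by (intro has_derivative_Pair d1 has_derivative_snd[OF has_derivative_ident])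
    have d3: "((\<lambda>(z, t). g z t) has_derivative
        (\<lambda>h. inner h (gz (\<phi> z) (snd z), gt (\<phi> z) (snd z)))) (at (\<phi> z, snd z))"
      using deriv[OF s] by (simp add: gderiv_def)
    have "(\<psi> has_derivative (\<lambda>h. inner (inner h (G z), snd h) (gz (\<phi> z) (snd z), gt (\<phi> z) (snd z)))) (at z)"
      using has_derivative_compose[OF d2 d3] by (simp add: \<psi>_def[abs_def])
    moreover have "(\<lambda>h. inner (inner h (G z), snd h) (gz (\<phi> z) (snd z), gt (\<phi> z) (snd z)))
        = (\<lambda>h. inner h (H z))"
      by (auto simp: fun_eq_iff H_def inner_prod_def algebra_simps)
    ultimately show "GDERIV \<psi> z :> H z" by (simp add: gderiv_def)
  next
    have c: "continuous_on (cylinder T) (\<lambda>z. (\<phi> z, snd z))"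
      by (intro continuous_intros \<phi>cont)
    have im: "(\<lambda>z. (\<phi> z, snd z)) ` cylinder T \<subseteq> UNIV \<times> {0<..<T}"
      by (auto simp: cylinder_def)
    have "continuous_on (cylinder T) (\<lambda>z. gz (\<phi> z) (snd z))"
      "continuous_on (cylinder T) (\<lambda>z. gt (\<phi> z) (snd z))"
      using continuous_on_compose2[OF cont(1) c im] continuous_on_compose2[OF cont(2) c im] by auto
    then show "continuous_on (cylinder T) H"
      using C1 unfolding H_def C1_with_gradient_def by (intro continuous_intros) auto
  qed
  have "\<forall>\<^sub>F z in nhds (x, t). z \<in> cylinder T"
    by (rule eventually_nhds_in_open[OF open_cylinder mem])
  with ev have ev': "\<forall>\<^sub>F z in nhds (x, t). u (fst z) (snd z) \<le> \<psi> z"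
  proof eventually_elim
    case (elim z)
    then have s: "0 < snd z" "snd z < T" by (auto simp: cylinder_def)
    show ?case using monoD[OF mono[OF s] elim(1)] inv[OF s, of "fst z"] by (simp add: \<psi>_def)
  qed
  have "u x t = \<psi> (x, t)" using inv[OF t, of x] eq by (simp add: \<psi>_def)
  with u C1' t ev' have "snd (H (x, t)) \<le> F x t (\<psi> (x, t)) (fst (H (x, t)))"
    unfolding csub_def by blast
  then have "gz (\<phi> (x,t)) t * snd (G (x,t)) + gt (\<phi> (x,t)) t
      \<le> F x t (g (\<phi> (x,t)) t) (gz (\<phi> (x,t)) t *\<^sub>R fst (G (x,t)))"
    by (simp add: H_def \<psi>_def)
  also note F[OF t]
  finally have "gz (\<phi> (x,t)) t * snd (G (x,t)) \<le> gz (\<phi> (x,t)) t * F' x t (\<phi> (x,t)) (fst (G (x,t)))"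
    by simp
  then show "snd (G (x, t)) \<le> F' x t (\<phi> (x, t)) (fst (G (x, t)))"
    using pos[OF t, of "\<phi> (x,t)"] by simp
qed

subsection \<open>Doubling of variables\<close>

text \<open>One family of test functions serves all touching arguments: a weighted paraboloid, a
  rounded cone, a barrier at time \<open>T\<close> and a quadratic penalty in time. Zero
  coefficients switch off single terms; \<open>0 < b\<close> keeps the rounded cone smooth at its
  apex.\<close>

lemma C1_with_gradient_penalty:
  fixes y a :: "'a::euclidean_space"
  assumes b: "0 < b"
  shows "C1_with_gradient (cylinder T)
    (\<lambda>(x, t). exp (\<kappa> * t) * (k + c * (norm (x - y))\<^sup>2) + \<alpha> * sqrt (b + (norm (x - a))\<^sup>2) + \<gamma> / (T - t)
       + N * (t - s)\<^sup>2 + k0)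
    (\<lambda>(x, t). ((2 * c * exp (\<kappa> * t)) *\<^sub>R (x - y) + (\<alpha> / sqrt (b + (norm (x - a))\<^sup>2)) *\<^sub>R (x - a),
       \<kappa> * exp (\<kappa> * t) * (k + c * (norm (x - y))\<^sup>2) + \<gamma> / (T - t)\<^sup>2 + 2 * N * (t - s)))"
    (is "C1_with_gradient _ ?f ?G")
  unfolding C1_with_gradient_def
proof (intro conjI ballI)
  fix z :: "'a \<times> real" assume z: "z \<in> cylinder T"
  obtain x t where [simp]: "z = (x, t)" by (cases z)
  have t: "T - t \<noteq> 0" using z by (auto simp: cylinder_def)
  have J: "0 < b + (norm (x - a))\<^sup>2" using b by (simp add: add_pos_nonneg)
  have e0: "GDERIV snd z :> (0, 1)"
    unfolding gderiv_def by (auto intro!: derivative_eq_intros simp: inner_prod_def)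
  have e2: "GDERIV (\<lambda>z::'a \<times> real. k + c * (norm (fst z - y))\<^sup>2) z :> ((2 * c) *\<^sub>R (x - y), 0)"
    for k c y
    unfolding gderiv_def power2_norm_eq_inner
    by (rule derivative_eq_intros refl)+ (simp add: inner_prod_def inner_commute fun_eq_iff)
  have "GDERIV (\<lambda>z. exp (\<kappa> * snd z)) z :> (exp (\<kappa> * snd z) * \<kappa>) *\<^sub>R (0, 1)"
    by (rule GDERIV_DERIV_compose[OF e0, of "\<lambda>t. exp (\<kappa> * t)"]) (auto intro!: derivative_eq_intros)
  from GDERIV_mult[OF this e2]
  have d1: "GDERIV (\<lambda>z. exp (\<kappa> * snd z) * (k + c * (norm (fst z - y))\<^sup>2)) z
      :> ((2 * c * exp (\<kappa> * t)) *\<^sub>R (x - y), \<kappa> * exp (\<kappa> * t) * (k + c * (norm (x - y))\<^sup>2))"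
    by (simp add: mult_ac)
  have e3: "GDERIV (\<lambda>z::'a \<times> real. b + (norm (fst z - a))\<^sup>2) z :> (2 *\<^sub>R (x - a), 0)"
    using e2[of b 1 a] by simp
  have e4: "((\<lambda>r. \<alpha> * sqrt r) has_real_derivative \<alpha> * (inverse (sqrt (b + (norm (x - a))\<^sup>2)) / 2))
      (at (b + (norm (fst z - a))\<^sup>2))"
    using DERIV_cmult[OF DERIV_real_sqrt[OF J]] by simp
  have e5: "(d * (inverse j / 2)) *\<^sub>R (2 *\<^sub>R (x - a), 0::real) = ((d / j) *\<^sub>R (x - a), 0)" for d j :: real
    by (simp add: field_simps)
  have d2: "GDERIV (\<lambda>z. \<alpha> * sqrt (b + (norm (fst z - a))\<^sup>2)) z
      :> ((\<alpha> / sqrt (b + (norm (x - a))\<^sup>2)) *\<^sub>R (x - a), 0)"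
    using GDERIV_DERIV_compose[OF e3 e4] unfolding e5 by simp
  have "((\<lambda>t. \<gamma> / (T - t)) has_real_derivative \<gamma> / (T - t)\<^sup>2) (at (snd z))"
    using t by (auto intro!: derivative_eq_intros simp: power2_eq_square)
  from GDERIV_DERIV_compose[OF e0 this]
  have d3: "GDERIV (\<lambda>z::'a \<times> real. \<gamma> / (T - snd z)) z :> (0, \<gamma> / (T - t)\<^sup>2)" by simp
  have "((\<lambda>t. N * (t - s)\<^sup>2 + k0) has_real_derivative 2 * N * (t - s)) (at (snd z))"
    by (auto intro!: derivative_eq_intros)
  from GDERIV_DERIV_compose[OF e0 this]
  have d4: "GDERIV (\<lambda>z::'a \<times> real. N * (snd z - s)\<^sup>2 + k0) z :> (0, 2 * N * (t - s))" by simp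
  have "?f = (\<lambda>z. exp (\<kappa> * snd z) * (k + c * (norm (fst z - y))\<^sup>2) + \<alpha> * sqrt (b + (norm (fst z - a))\<^sup>2)
      + \<gamma> / (T - snd z) + (N * (snd z - s)\<^sup>2 + k0))"
    by (auto simp: fun_eq_iff)
  then show "GDERIV ?f z :> ?G z"
    using GDERIV_add[OF GDERIV_add[OF GDERIV_add[OF d1 d2] d3] d4] by simp
next
  have "0 < b + (norm (x - a))\<^sup>2" for x using b by (simp add: add_pos_nonneg)
  then have J0: "b + (norm (x - a))\<^sup>2 \<noteq> 0" for x by (metis less_irrefl)
  show "continuous_on (cylinder T) ?G"
    unfolding case_prod_beta cylinder_def by (intro continuous_intros) (auto simp: J0)
qed

section \<open>Continuity of compositions and evaluation at touching points\<close>

lemma continuous_on_compose_curried2: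
  assumes "continuous_on S (\<lambda>(x, y). f x y)" "continuous_on A a" "continuous_on A b"
    "\<And>z. z \<in> A \<Longrightarrow> (a z, b z) \<in> S"
  shows "continuous_on A (\<lambda>z. f (a z) (b z))"
  using continuous_on_compose2[OF assms(1) continuous_on_Pair[OF assms(2,3)]] assms(4) by auto

lemma continuous_on_compose_curried4:
  assumes "continuous_on S (\<lambda>(x, y, z, w). f x y z w)"
    "continuous_on A a" "continuous_on A b" "continuous_on A c" "continuous_on A d"
    "\<And>z. z \<in> A \<Longrightarrow> (a z, b z, c z, d z) \<in> S"
  shows "continuous_on A (\<lambda>z. f (a z) (b z) (c z) (d z))"
  using continuous_on_compose2[OF assms(1)
      continuous_on_Pair[OF assms(2) continuous_on_Pair[OF assms(3) continuous_on_Pair[OF assms(4,5)]]]]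
    assms(6) by auto

lemma csub_testD:
  assumes "csub T F u" "C1_with_gradient (cylinder T) \<phi> G" "open Q" "(x, t) \<in> Q" "0 < t" "t < T"
    "u x t = \<phi> (x, t)" "\<And>y s. (y, s) \<in> Q \<Longrightarrow> u y s \<le> \<phi> (y, s)"
  shows "snd (G (x, t)) \<le> F x t (u x t) (fst (G (x, t)))"
proof -
  have "\<forall>\<^sub>F z in nhds (x, t). z \<in> Q" by (rule eventually_nhds_in_open[OF assms(3,4)])
  then have "\<forall>\<^sub>F z in nhds (x, t). u (fst z) (snd z) \<le> \<phi> z"
    by eventually_elim (use assms(8) in auto)
  with assms(1,2,5,6,7) have "snd (G (x, t)) \<le> F x t (\<phi> (x, t)) (fst (G (x, t)))"
    unfolding csub_def by blast
  then show ?thesis using assms(7) by simp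
qed

text \<open>The hypothesis on \<open>m\<close> says that \<open>m (norm z)\<close> is touched from above by a paraboloid, which serves
  as the test function. It covers paraboloids with \<open>D = UNIV\<close> and cones, which are not
  differentiable at the vertex, with \<open>D = {0<..}\<close>.\<close>

lemma doubling:
  fixes U V :: "'a::euclidean_space \<Rightarrow> real \<Rightarrow> real" and m c :: "real \<Rightarrow> real"
  assumes T: "T > 0"
    and U: "csub T F U" and V: "csub T G V"
    and contU: "continuous_on (UNIV \<times> {0..<T}) (\<lambda>(x, t). U x t)"
    and contV: "continuous_on (UNIV \<times> {0..<T}) (\<lambda>(x, t). V x t)"
    and contF: "continuous_on (UNIV \<times> {0<..<T} \<times> UNIV \<times> UNIV) (\<lambda>(x, t, r, p). F x t r p)"
    and contG: "continuous_on (UNIV \<times> {0<..<T} \<times> UNIV \<times> UNIV) (\<lambda>(x, t, r, p). G x t r p)"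
    and contm: "continuous_on UNIV m" and contc: "continuous_on D c" and openD: "open D"
    and mc: "\<And>r s. r \<in> D \<Longrightarrow> 0 \<le> s \<Longrightarrow> m s \<le> m r + c r * (s\<^sup>2 - r\<^sup>2)"
    and growth: "\<And>x y t. 0 \<le> t \<Longrightarrow> t < T \<Longrightarrow>
      U x t + V y t - exp (\<kappa> * t) * m (norm (x - y)) \<le> C - norm (x - y)"
    and init: "\<And>x y. U x 0 + V y 0 \<le> m (norm (x - y))"
    and D: "\<And>x y t. 0 < t \<Longrightarrow> t < T \<Longrightarrow> exp (\<kappa> * t) * m (norm (x - y)) < U x t + V y t \<Longrightarrow>
      norm (x - y) \<in> D"
    and t1: "0 \<le> t1" "t1 < T"
    and pt: "exp (\<kappa> * t1) * m (norm (x1 - y1)) < U x1 t1 + V y1 t1"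
    and \<Lambda>: "0 < \<Lambda>"
  obtains x y t \<alpha> q where "0 < t" "t < T" "0 < \<alpha>" "\<alpha> < 1" "norm q \<le> 1"
    "exp (\<kappa> * t) * m (norm (x - y)) < U x t + V y t"
    "\<kappa> * exp (\<kappa> * t) * m (norm (x - y)) + \<Lambda> * \<alpha>
      < F x t (U x t) ((2 * c (norm (x - y)) * exp (\<kappa> * t)) *\<^sub>R (x - y) + \<alpha> *\<^sub>R q)
        + G y t (V y t) (- ((2 * c (norm (x - y)) * exp (\<kappa> * t)) *\<^sub>R (x - y)))"
proof -
  \<comment> \<open>written with \<open>x - 0\<close> to match the test functions of \<open>C1_with_gradient_penalty\<close>\<close>
  define J :: "'a \<Rightarrow> real" where "J x = sqrt (1 + (norm (x - 0))\<^sup>2)" for x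
  have Jpos: "0 < J x" for x by (simp add: J_def add_pos_nonneg)
  have Jnorm: "norm x \<le> J x" for x unfolding J_def by (intro real_le_rsqrt) simp
  have contJ: "continuous_on A J" for A unfolding J_def by (intro continuous_intros)
  \<comment> \<open>The excess \<open>\<delta>\<close> is split into thirds: at the given point each
    of the penalties \<open>\<gamma> / (T - t)\<close> and \<open>\<alpha> * J x\<close> costs at
    most \<open>\<delta> / 3\<close>. The last bound in \<open>\<alpha>\<close> makes
    \<open>\<Lambda> * \<alpha>\<close> smaller than the time derivative of the first
    penalty.\<close>
  define \<delta> where "\<delta> = U x1 t1 + V y1 t1 - exp (\<kappa> * t1) * m (norm (x1 - y1))"
  have \<delta>: "\<delta> > 0" using pt by (simp add: \<delta>_def)
  define \<gamma> where "\<gamma> = \<delta> * (T - t1) / 3"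
  have \<gamma>: "\<gamma> > 0" using \<delta> t1 by (simp add: \<gamma>_def)
  define \<alpha> where "\<alpha> = min (1/2) (min (\<delta> / (3 * J x1)) (\<gamma> / (2 * \<Lambda> * T\<^sup>2)))"
  have \<alpha>: "0 < \<alpha>" "\<alpha> < 1"
    using \<delta> \<gamma> \<Lambda> T Jpos[of x1] by (auto simp: \<alpha>_def)
  have \<alpha>1: "\<alpha> * J x1 \<le> \<delta> / 3"
  proof -
    have "\<alpha> \<le> \<delta> / (3 * J x1)" by (simp add: \<alpha>_def)
    then show ?thesis using Jpos[of x1] by (simp add: field_simps)
  qed
  have \<alpha>2: "\<Lambda> * \<alpha> < \<gamma> / T\<^sup>2"
  proof -
    have "\<alpha> \<le> \<gamma> / (2 * \<Lambda> * T\<^sup>2)" by (simp add: \<alpha>_def)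
    then have "2 * (\<Lambda> * \<alpha>) \<le> \<gamma> / T\<^sup>2" using \<Lambda> T by (simp add: field_simps)
    moreover have "0 < \<Lambda> * \<alpha>" using \<Lambda> \<alpha> by simp
    ultimately show ?thesis by linarith
  qed
  define P where "P = (\<lambda>(x, t, y, s). U x t + V y s - exp (\<kappa> * t) * m (norm (x - y)) - \<alpha> * J x - \<gamma> / (T - t))"
  have P1: "0 < P (x1, t1, y1, t1)"
  proof -
    have "\<delta> * d / 3 / d = \<delta> / 3" if "d \<noteq> 0" for d using that by simp
    from this[of "T - t1"] have "\<gamma> / (T - t1) = \<delta> / 3" using t1 unfolding \<gamma>_def by linarith
    then show ?thesis using \<alpha>1 \<delta> by (simp add: P_def \<delta>_def)
  qed
  \<comment> \<open>At equal times positivity of \<open>P\<close> localises: \<open>growth\<close>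
    bounds \<open>norm (x - y) + \<alpha> * J x + \<gamma> / (T - t)\<close> by \<open>C\<close>,
    which bounds \<open>x\<close> and \<open>y\<close> and keeps \<open>t\<close> away from
    \<open>T\<close>; \<open>init\<close> excludes \<open>t = 0\<close>.\<close>
  have Ppos: "norm x < C / \<alpha> + C \<and> norm y < C / \<alpha> + C \<and> 0 < t \<and> t < T - \<gamma> / C \<and> 0 < C
      \<and> exp (\<kappa> * t) * m (norm (x - y)) < U x t + V y t"
    if "0 \<le> t" "t < T" "0 < P (x, t, y, t)" for x y t
  proof -
    have g0: "0 < \<gamma> / (T - t)" using that \<gamma> by simp
    have a0: "0 < \<alpha> * J x" using \<alpha> Jpos by simp
    have 1: "norm (x - y) + \<alpha> * J x + \<gamma> / (T - t) < C"
      using growth[OF that(1,2), of x y] that(3) by (simp add: P_def)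
    have C: "0 < C" using 1 a0 g0 norm_ge_zero[of "x - y"] by linarith
    have "\<alpha> * norm x \<le> \<alpha> * J x" using Jnorm[of x] \<alpha> by simp
    then have "\<alpha> * norm x < C" using 1 g0 norm_ge_zero[of "x - y"] by linarith
    then have x: "norm x < C / \<alpha>" using \<alpha> by (simp add: field_simps)
    have xy: "norm (x - y) < C" using 1 a0 g0 by linarith
    have "norm y \<le> norm x + norm (x - y)" by (metis norm_minus_commute norm_triangle_sub)
    then have y: "norm y < C / \<alpha> + C" using x xy by linarith
    have "\<gamma> / (T - t) < C" using 1 a0 norm_ge_zero[of "x - y"] by linarith
    then have tt: "t < T - \<gamma> / C" using that C by (simp add: field_simps)
    have pos: "exp (\<kappa> * t) * m (norm (x - y)) < U x t + V y t"
      using that(3) a0 g0 by (simp add: P_def)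
    then have "t \<noteq> 0" using init[of x y] by force
    then show ?thesis using x y tt C pos that by auto
  qed
  define R where "R = C / \<alpha> + C"
  define T1 where "T1 = T - \<gamma> / C"
  have pt1: "norm x1 < R" "norm y1 < R" "t1 < T1" "0 < C"
    using Ppos[OF t1 P1] by (auto simp: R_def T1_def)
  have T1: "0 < T1" "T1 < T" using pt1 \<gamma> t1 by (auto simp: T1_def)
  define K where "K = cball (0::'a) R \<times> {0..T1} \<times> cball (0::'a) R \<times> {0..T1}"
  have K: "compact K" unfolding K_def by (intro compact_Times compact_cball compact_Icc)
  have K1: "(x1, t1, y1, t1) \<in> K" using pt1 t1 by (simp add: K_def)
  have contP: "continuous_on K P"
  proof -
    have c1: "continuous_on K (\<lambda>z. U (fst z) (fst (snd z)))"
      by (rule continuous_on_compose_curried2[OF contU])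
         (use T1 in \<open>auto simp: K_def intro!: continuous_intros\<close>)
    have c2: "continuous_on K (\<lambda>z. V (fst (snd (snd z))) (snd (snd (snd z))))"
      by (rule continuous_on_compose_curried2[OF contV])
         (use T1 in \<open>auto simp: K_def intro!: continuous_intros\<close>)
    have c3: "continuous_on K (\<lambda>z. m (norm (fst z - fst (snd (snd z)))))"
      by (rule continuous_on_compose2[OF contm]) (auto intro!: continuous_intros)
    have c4: "continuous_on K (\<lambda>z. J (fst z))"
      by (rule continuous_on_compose2[OF contJ[of UNIV]]) (auto intro!: continuous_intros)
    show ?thesis unfolding P_def case_prod_beta
      by (intro continuous_intros c1 c2 c3 c4) (use T1 in \<open>auto simp: K_def\<close>)
  qed
  \<comment> \<open>Only the gap between the two times receives a growing penalty; the spatial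
    function \<open>m\<close> stays fixed as \<open>n\<close> tends to infinity.\<close>
  define \<Theta> where "\<Theta> n z = P z - real n * (fst (snd z) - snd (snd (snd z)))\<^sup>2" for n z
  have "\<exists>z\<in>K. \<forall>z'\<in>K. \<Theta> n z' \<le> \<Theta> n z" for n
    by (rule continuous_attains_sup[OF K]) (use K1 in \<open>auto simp: \<Theta>_def intro!: continuous_intros contP\<close>)
  then obtain Z where Z: "\<And>n. Z n \<in> K" "\<And>n z'. z' \<in> K \<Longrightarrow> \<Theta> n z' \<le> \<Theta> n (Z n)" by metis
  obtain l r where l: "l \<in> K" and r: "strict_mono r" and lim: "(Z \<circ> r) \<longlonglongrightarrow> l"
    using K Z(1) unfolding compact_def by metis
  obtain xl tl yl sl where l_eq: "l = (xl, tl, yl, sl)" by (cases l) auto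
  define \<delta>1 where "\<delta>1 = P (x1, t1, y1, t1)"
  have PZ: "\<delta>1 + real n * (fst (snd (Z n)) - snd (snd (snd (Z n))))\<^sup>2 \<le> P (Z n)" for n
    using Z(2)[OF K1, of n] by (simp add: \<Theta>_def \<delta>1_def)
  obtain B where B: "\<And>z. z \<in> K \<Longrightarrow> P z \<le> B"
    using continuous_attains_sup[OF K _ contP] K1 by blast
  have limP: "(\<lambda>n. P (Z (r n))) \<longlonglongrightarrow> P l"
    using continuous_on_tendsto_compose[OF contP lim[unfolded comp_def] l] Z(1) by simp
  have "\<delta>1 \<le> P l"
  proof (rule LIMSEQ_le_const[OF limP], intro exI allI impI)
    fix n show "\<delta>1 \<le> P (Z (r n))" using PZ[of "r n"]
      by (smt (verit) mult_nonneg_nonneg of_nat_0_le_iff zero_le_power2)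
  qed
  then have Pl: "0 < P l" using P1 by (simp add: \<delta>1_def)
  have limts: "(\<lambda>n. (fst (snd (Z (r n))) - snd (snd (snd (Z (r n)))))\<^sup>2) \<longlonglongrightarrow> (tl - sl)\<^sup>2"
    using tendsto_fst[OF tendsto_snd[OF lim[unfolded comp_def l_eq]]]
      tendsto_snd[OF tendsto_snd[OF tendsto_snd[OF lim[unfolded comp_def l_eq]]]]
    by (intro tendsto_intros) simp_all
  \<comment> \<open>\<open>P\<close> is at most \<open>B\<close> on \<open>K\<close>, and at the
    maximum points it exceeds \<open>\<delta>1\<close> by at least the time penalty, so
    \<open>n\<close> times the squared gap stays bounded.\<close>
  have limts0: "(\<lambda>n. (fst (snd (Z (r n))) - snd (snd (snd (Z (r n)))))\<^sup>2) \<longlonglongrightarrow> 0"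
  proof (rule tendsto_sandwich[of "\<lambda>_. 0" _ _ "\<lambda>n. \<bar>B - \<delta>1\<bar> / real n"])
    show "\<forall>\<^sub>F n in sequentially. (fst (snd (Z (r n))) - snd (snd (snd (Z (r n)))))\<^sup>2 \<le> \<bar>B - \<delta>1\<bar> / real n"
      using eventually_gt_at_top[of 0]
    proof eventually_elim
      case (elim n)
      let ?q = "(fst (snd (Z (r n))) - snd (snd (snd (Z (r n)))))\<^sup>2"
      have "real n * ?q \<le> real (r n) * ?q"
        using seq_suble[OF r, of n] by (intro mult_right_mono) auto
      also have "\<dots> \<le> \<bar>B - \<delta>1\<bar>" using PZ[of "r n"] B[OF Z(1), of "r n"] by linarith
      finally show ?case using elim by (simp add: field_simps)
    qed
    show "(\<lambda>n. \<bar>B - \<delta>1\<bar> / real n) \<longlonglongrightarrow> 0" by (rule lim_const_over_n)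
  qed auto
  have sl: "sl = tl" using LIMSEQ_unique[OF limts limts0] by simp
  have tl: "0 \<le> tl" "tl < T" using l T1 by (auto simp: l_eq K_def)
  have l_in: "norm xl < R" "norm yl < R" "0 < tl" "tl < T1"
    "exp (\<kappa> * tl) * m (norm (xl - yl)) < U xl tl + V yl tl"
    using Ppos[OF tl, of xl yl] Pl by (auto simp: l_eq sl R_def T1_def)
  have lD: "norm (xl - yl) \<in> D" using D[OF l_in(3) tl(2) l_in(5)] .
  \<comment> \<open>The limit has equal times and a positive value of \<open>P\<close>, hence it is
    interior and its distance lies in \<open>D\<close>. Thus \<open>W\<close> is a neighbourhood of
    it, and the maximum points enter \<open>W\<close> eventually.\<close>
  define O1 where "O1 = ball (0::'a) R \<times> {0<..<T1} \<times> ball (0::'a) R \<times> {0<..<T1}"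
  define W where "W = O1 \<inter> (\<lambda>z. norm (fst z - fst (snd (snd z)))) -` D"
  have W: "open W" unfolding W_def
    by (intro open_Int continuous_open_vimage openD continuous_intros)
       (auto simp: O1_def intro!: open_Times)
  have lW: "l \<in> W" using l_in lD by (auto simp: W_def O1_def l_eq sl)
  define p where "p = (\<lambda>(x::'a, t::real, y::'a, s::real). (2 * c (norm (x - y)) * exp (\<kappa> * t)) *\<^sub>R (x - y))"
  define lhs where "lhs = (\<lambda>(x::'a, t, y::'a, s::real). \<kappa> * exp (\<kappa> * t) * m (norm (x - y)) + \<gamma> / (T - t)\<^sup>2)"
  define rhs where "rhs = (\<lambda>(x, t, y, s). F x t (U x t) (p (x, t, y, s) + (\<alpha> / J x) *\<^sub>R x)
      + G y s (V y s) (- p (x, t, y, s)))"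
  \<comment> \<open>Freezing one pair of variables at a maximum gives a test function for the other.
    Replacing \<open>m\<close> by the paraboloid touching it from above at \<open>rr\<close> keeps
    the maximum and makes the test function smooth. The derivatives \<open>2 n (t - s)\<close> and
    \<open>2 n (s - t)\<close> cancel in the sum.\<close>
  have ineq: "lhs (Z n) \<le> rhs (Z n)" if ZW: "Z n \<in> W" for n
  proof -
    obtain x t y s where z: "Z n = (x, t, y, s)" by (cases "Z n") auto
    have inW: "norm x < R" "norm y < R" "0 < t" "t < T1" "0 < s" "s < T1" "norm (x - y) \<in> D"
      using ZW by (auto simp: z W_def O1_def)
    define rr where "rr = norm (x - y)"
    define k where "k = m rr - c rr * rr\<^sup>2"
    have mk: "m \<sigma> \<le> k + c rr * \<sigma>\<^sup>2" if "0 \<le> \<sigma>" for \<sigma>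
      using mc[OF inW(7) that] by (simp add: k_def rr_def algebra_simps)
    have mk0: "k + c rr * rr\<^sup>2 = m rr" by (simp add: k_def)
    have Q: "open (ball (0::'a) R \<times> {0<..<T1})" by (intro open_Times) auto
    define k1 where "k1 = U x t - exp (\<kappa> * t) * m rr - \<alpha> * J x - \<gamma> / (T - t) - real n * (t - s)\<^sup>2"
    have "snd ((\<lambda>(x, t). ((2 * c rr * exp (\<kappa> * t)) *\<^sub>R (x - y) + (\<alpha> / sqrt (1 + (norm (x - 0))\<^sup>2)) *\<^sub>R (x - 0),
         \<kappa> * exp (\<kappa> * t) * (k + c rr * (norm (x - y))\<^sup>2) + \<gamma> / (T - t)\<^sup>2 + 2 * real n * (t - s))) (x, t))
        \<le> F x t (U x t) (fst ((\<lambda>(x, t). ((2 * c rr * exp (\<kappa> * t)) *\<^sub>R (x - y) + (\<alpha> / sqrt (1 + (norm (x - 0))\<^sup>2)) *\<^sub>R (x - 0),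
         \<kappa> * exp (\<kappa> * t) * (k + c rr * (norm (x - y))\<^sup>2) + \<gamma> / (T - t)\<^sup>2 + 2 * real n * (t - s))) (x, t)))"
    proof (rule csub_testD[OF U C1_with_gradient_penalty[OF zero_less_one, where ?k0.0 = k1] Q])
      fix x' t' assume "(x', t') \<in> ball (0::'a) R \<times> {0<..<T1}"
      then have "(x', t', y, s) \<in> K" using inW by (auto simp: K_def)
      from Z(2)[OF this, of n]
      have "U x' t' - exp (\<kappa> * t') * m (norm (x' - y)) - \<alpha> * J x' - \<gamma> / (T - t') - real n * (t' - s)\<^sup>2 \<le> k1"
        by (simp add: z \<Theta>_def P_def k1_def rr_def)
      moreover have "exp (\<kappa> * t') * m (norm (x' - y)) \<le> exp (\<kappa> * t') * (k + c rr * (norm (x' - y))\<^sup>2)"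
        using mk by (intro mult_left_mono) auto
      ultimately show "U x' t' \<le> (case (x', t') of (x, t) \<Rightarrow>
          exp (\<kappa> * t) * (k + c rr * (norm (x - y))\<^sup>2) + \<alpha> * sqrt (1 + (norm (x - 0))\<^sup>2) + \<gamma> / (T - t) + real n * (t - s)\<^sup>2 + k1)"
        unfolding J_def prod.case by linarith
    qed (use inW T1 mk0 in \<open>auto simp: k1_def J_def rr_def\<close>)
    then have 1: "\<kappa> * exp (\<kappa> * t) * m rr + \<gamma> / (T - t)\<^sup>2 + 2 * real n * (t - s)
        \<le> F x t (U x t) (p (x, t, y, s) + (\<alpha> / J x) *\<^sub>R x)"
      using mk0 by (simp add: p_def J_def rr_def)
    \<comment> \<open>For \<open>V\<close> the weight is the constant \<open>e\<close>, frozen at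
      time \<open>t\<close>; hence the rate 0 below, and the term with \<open>\<kappa>\<close> comes
      from \<open>U\<close> alone.\<close>
    define e where "e = exp (\<kappa> * t)"
    define k2 where "k2 = V y s - e * m rr - real n * (t - s)\<^sup>2"
    have "snd ((\<lambda>(y, s). ((2 * (e * c rr) * exp (0 * s)) *\<^sub>R (y - x) + (0 / sqrt (1 + (norm (y - 0))\<^sup>2)) *\<^sub>R (y - 0),
         0 * exp (0 * s) * (e * k + (e * c rr) * (norm (y - x))\<^sup>2) + 0 / (T - s)\<^sup>2 + 2 * real n * (s - t))) (y, s))
        \<le> G y s (V y s) (fst ((\<lambda>(y, s). ((2 * (e * c rr) * exp (0 * s)) *\<^sub>R (y - x) + (0 / sqrt (1 + (norm (y - 0))\<^sup>2)) *\<^sub>R (y - 0),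
         0 * exp (0 * s) * (e * k + (e * c rr) * (norm (y - x))\<^sup>2) + 0 / (T - s)\<^sup>2 + 2 * real n * (s - t))) (y, s)))"
    proof (rule csub_testD[OF V C1_with_gradient_penalty[OF zero_less_one, where ?k0.0 = k2] Q])
      fix y' s' assume "(y', s') \<in> ball (0::'a) R \<times> {0<..<T1}"
      then have "(x, t, y', s') \<in> K" using inW by (auto simp: K_def)
      from Z(2)[OF this, of n]
      have "V y' s' - e * m (norm (y' - x)) - real n * (s' - t)\<^sup>2 \<le> k2"
        by (simp add: z \<Theta>_def P_def k2_def rr_def e_def norm_minus_commute power2_commute)
      moreover have "e * m (norm (y' - x)) \<le> e * (k + c rr * (norm (y' - x))\<^sup>2)"
        using mk by (intro mult_left_mono) (auto simp: e_def)
      ultimately show "V y' s' \<le> (case (y', s') of (y, s) \<Rightarrow>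
          exp (0 * s) * (e * k + e * c rr * (norm (y - x))\<^sup>2) + 0 * sqrt (1 + (norm (y - 0))\<^sup>2) + 0 / (T - s) + real n * (s - t)\<^sup>2 + k2)"
        by (simp add: algebra_simps mult.assoc)
    next
      have "e * k + e * c rr * (norm (y - x))\<^sup>2 = e * m rr"
        unfolding mk0[symmetric] by (simp add: rr_def norm_minus_commute algebra_simps)
      then show "V y s = (case (y, s) of (y, s) \<Rightarrow>
          exp (0 * s) * (e * k + e * c rr * (norm (y - x))\<^sup>2) + 0 * sqrt (1 + (norm (y - 0))\<^sup>2) + 0 / (T - s) + real n * (s - t)\<^sup>2 + k2)"
        by (simp add: k2_def power2_commute)
    qed (use inW T1 in auto)
    moreover have "(2 * (e * c rr)) *\<^sub>R (y - x) = - p (x, t, y, s)"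
      by (simp add: p_def e_def rr_def scaleR_diff_right mult_ac)
    ultimately have 2: "2 * real n * (s - t) \<le> G y s (V y s) (- p (x, t, y, s))" by simp
    have "lhs (Z n) + (2 * real n * (t - s) + 2 * real n * (s - t)) \<le> rhs (Z n)"
      using 1 2 by (simp add: z lhs_def rhs_def rr_def)
    then show ?thesis by (simp add: algebra_simps)
  qed
  have WT: "0 < fst (snd z)" "fst (snd z) < T" "0 < snd (snd (snd z))" "snd (snd (snd z)) < T" if "z \<in> W" for z
    using that T1 by (auto simp: W_def O1_def)
  have WT': "0 \<le> t" "0 \<le> s" "0 < t" "t < T" "0 < s" "s < T" if "(x, t, y, s) \<in> W" for x t y s
    using WT[OF that] by auto
  have contp: "continuous_on W p"
  proof -
    have "continuous_on W (\<lambda>z. c (norm (fst z - fst (snd (snd z)))))"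
      by (rule continuous_on_compose2[OF contc]) (auto simp: W_def intro!: continuous_intros)
    then show ?thesis unfolding p_def case_prod_beta by (intro continuous_intros)
  qed
  have contlhs: "continuous_on W lhs"
  proof -
    have "continuous_on W (\<lambda>z. m (norm (fst z - fst (snd (snd z)))))"
      by (rule continuous_on_compose2[OF contm]) (auto intro!: continuous_intros)
    moreover have "T - fst (snd z) \<noteq> 0" if "z \<in> W" for z using WT(2)[OF that] by simp
    ultimately show ?thesis unfolding lhs_def case_prod_beta
      by (intro continuous_intros) auto
  qed
  have contrhs: "continuous_on W rhs"
  proof -
    have c1: "continuous_on W (\<lambda>z. U (fst z) (fst (snd z)))"
      by (rule continuous_on_compose_curried2[OF contU])
         (auto intro!: continuous_intros dest: WT')
    have c2: "continuous_on W (\<lambda>z. V (fst (snd (snd z))) (snd (snd (snd z))))"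
      by (rule continuous_on_compose_curried2[OF contV])
         (auto intro!: continuous_intros dest: WT')
    have c4: "continuous_on W (\<lambda>z. J (fst z))"
      by (rule continuous_on_compose2[OF contJ[of UNIV]]) (auto intro!: continuous_intros)
    have J0: "J x \<noteq> 0" for x using Jpos[of x] by simp
    have c5: "continuous_on W (\<lambda>z. p z + (\<alpha> / J (fst z)) *\<^sub>R fst z)"
      by (intro continuous_intros c4 contp) (use J0 in auto)
    have a: "continuous_on W (\<lambda>z. F (fst z) (fst (snd z)) (U (fst z) (fst (snd z))) (p z + (\<alpha> / J (fst z)) *\<^sub>R fst z))"
      by (rule continuous_on_compose_curried4[OF contF _ _ c1 c5])
         (auto intro!: continuous_intros dest: WT')
    have b: "continuous_on W (\<lambda>z. G (fst (snd (snd z))) (snd (snd (snd z))) (V (fst (snd (snd z))) (snd (snd (snd z)))) (- p z))"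
      by (rule continuous_on_compose_curried4[OF contG _ _ c2 continuous_on_minus[OF contp]])
         (auto intro!: continuous_intros dest: WT')
    show ?thesis using continuous_on_add[OF a b] unfolding rhs_def case_prod_beta by simp
  qed
  have ev: "\<forall>\<^sub>F n in sequentially. Z (r n) \<in> W"
    using topological_tendstoD[OF lim W lW] by simp
  have le: "lhs l \<le> rhs l"
  proof (rule tendsto_le[OF sequentially_bot])
    show "(\<lambda>n. lhs (Z (r n))) \<longlonglongrightarrow> lhs l"
      by (rule continuous_on_tendsto_compose[OF contlhs lim[unfolded comp_def] lW ev])
    show "(\<lambda>n. rhs (Z (r n))) \<longlonglongrightarrow> rhs l"
      by (rule continuous_on_tendsto_compose[OF contrhs lim[unfolded comp_def] lW ev])
    show "\<forall>\<^sub>F n in sequentially. lhs (Z (r n)) \<le> rhs (Z (r n))"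
      using ev by eventually_elim (rule ineq)
  qed
  \<comment> \<open>The time derivative of the barrier is at least
    \<open>\<gamma> / T\<^sup>2\<close>, which exceeds \<open>\<Lambda> * \<alpha>\<close>; this
    makes the final inequality strict. The vector \<open>q\<close> is \<open>xl\<close> divided by
    \<open>J xl\<close>.\<close>
  have \<gamma>le: "\<gamma> / T\<^sup>2 \<le> \<gamma> / (T - tl)\<^sup>2"
    using \<gamma> tl l_in(3) T by (intro divide_left_mono power_mono) auto
  have q: "\<alpha> *\<^sub>R (xl /\<^sub>R J xl) = (\<alpha> / J xl) *\<^sub>R xl" by (simp add: divide_real_def)
  have "\<kappa> * exp (\<kappa> * tl) * m (norm (xl - yl)) + \<Lambda> * \<alpha>
      < F xl tl (U xl tl) ((2 * c (norm (xl - yl)) * exp (\<kappa> * tl)) *\<^sub>R (xl - yl) + \<alpha> *\<^sub>R (xl /\<^sub>R J xl))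
        + G yl tl (V yl tl) (- ((2 * c (norm (xl - yl)) * exp (\<kappa> * tl)) *\<^sub>R (xl - yl)))"
    using \<alpha>2 le \<gamma>le unfolding q l_eq lhs_def rhs_def p_def sl prod.case by linarith
  moreover have "norm (xl /\<^sub>R J xl) \<le> 1" using Jnorm[of xl] Jpos[of xl] by (simp add: field_simps)
  ultimately show thesis using that l_in(3,5) tl(2) \<alpha> by blast
qed

subsection \<open>Change of the dependent variable\<close>

text \<open>A smooth strictly increasing approximation of \<open>min r (r / E)\<close> that is explicitly invertible,
  the graph being a branch of a hyperbola.\<close>

definition smooth_min :: "real \<Rightarrow> real \<Rightarrow> real \<Rightarrow> real" where
  "smooth_min \<sigma> E r = ((r - sqrt (r\<^sup>2 + \<sigma>)) + (r + sqrt (r\<^sup>2 + \<sigma>)) / E) / 2"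

lemma abs_le_sqrt_sum:
  fixes r :: real assumes "0 \<le> \<sigma>" shows "\<bar>r\<bar> \<le> sqrt (r\<^sup>2 + \<sigma>)"
  using assms real_sqrt_le_mono[of "r\<^sup>2" "r\<^sup>2 + \<sigma>"] by simp

text \<open>With \<open>S = sqrt (r\<^sup>2 + \<sigma>)\<close> one has
  \<open>r - S \<le> 0 \<le> r + S\<close>. Dividing by \<open>E \<ge> 1\<close> lowers the
  nonnegative term and raises the nonpositive one.\<close>

lemma smooth_min_le:
  assumes "0 \<le> \<sigma>" "1 \<le> E" shows "smooth_min \<sigma> E r \<le> r" "smooth_min \<sigma> E r \<le> r / E"
proof -
  define S where "S = sqrt (r\<^sup>2 + \<sigma>)"
  have S: "0 \<le> r + S" "r - S \<le> 0" using abs_le_sqrt_sum[OF assms(1), of r] by (auto simp: S_def)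
  have "(r + S) / E \<le> r + S" using S(1) assms(2) by (simp add: divide_le_eq mult_left_le mult_le_cancel_left1)
  then show "smooth_min \<sigma> E r \<le> r" by (simp add: smooth_min_def S_def)
  have "(r - S) * E \<le> r - S" using mult_left_mono_neg[OF assms(2) S(2)] by simp
  then have "r - S \<le> (r - S) / E" using assms(2) by (simp add: le_divide_eq)
  then have "smooth_min \<sigma> E r \<le> ((r - S) / E + (r + S) / E) / 2"
    unfolding smooth_min_def S_def[symmetric] by (intro divide_right_mono add_right_mono) auto
  also have "\<dots> = r / E" by (simp add: add_divide_distrib diff_divide_distrib)
  finally show "smooth_min \<sigma> E r \<le> r / E" .
qed

text \<open>The root differs from \<open>\<bar>r\<bar>\<close> by at most
  \<open>sqrt \<sigma>\<close>, and with \<open>\<bar>r\<bar>\<close> in its place the formula is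
  exactly the minimum. This is how the smoothing is removed in the limit.\<close>

lemma smooth_min_ge:
  assumes "0 \<le> \<sigma>" "1 \<le> E" shows "min r (r / E) - sqrt \<sigma> \<le> smooth_min \<sigma> E r"
proof -
  define S where "S = sqrt (r\<^sup>2 + \<sigma>)"
  have S: "0 \<le> r + S" "r \<le> S" using abs_le_sqrt_sum[OF assms(1), of r] by (auto simp: S_def)
  have S2: "S \<le> \<bar>r\<bar> + sqrt \<sigma>"
    using sqrt_add_le_add_sqrt[of "r\<^sup>2" \<sigma>] assms(1) by (simp add: S_def)
  have \<sigma>: "0 \<le> sqrt \<sigma>" using assms by simp
  show ?thesis
  proof (cases "0 \<le> r")
    case True
    have "(r + r) / E \<le> (r + S) / E" using assms(2) S by (intro divide_right_mono) auto
    then have "2 * (r / E) \<le> (r + S) / E" by (simp add: add_divide_distrib)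
    moreover have "min r (r / E) \<le> r / E" by simp
    moreover have "S \<le> r + sqrt \<sigma>" using S2 True by simp
    ultimately show ?thesis using \<sigma> unfolding smooth_min_def S_def[symmetric] by argo
  next
    case False
    have "0 \<le> (r + S) / E" using assms(2) S by simp
    moreover have "min r (r / E) \<le> r" by simp
    moreover have "S \<le> sqrt \<sigma> - r" using S2 False by simp
    ultimately show ?thesis using \<sigma> unfolding smooth_min_def S_def[symmetric] by argo
  qed
qed

lemma smooth_min_1 [simp]: "smooth_min \<sigma> 1 r = r"
  by (simp add: smooth_min_def)

text \<open>The pairs \<open>(r, z)\<close> lie on the hyperbola
  \<open>(r - z) (r - E z) = (E - 1)\<^sup>2 \<sigma> / (4 E)\<close>. Solving this for
  \<open>r\<close> instead of \<open>z\<close> is again a quadratic equation.\<close>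

lemma smooth_min_inverse:
  fixes r :: real
  assumes "0 \<le> \<sigma>" "1 \<le> E"
  defines "z \<equiv> smooth_min \<sigma> E r"
  shows "(E + 1) / 2 * z + (E - 1) / 2 * sqrt (z\<^sup>2 + \<sigma> / E) = r"
proof -
  define S where "S = sqrt (r\<^sup>2 + \<sigma>)"
  have S2: "S\<^sup>2 = r\<^sup>2 + \<sigma>" using assms(1) by (simp add: S_def)
  have S: "\<bar>r\<bar> \<le> S" using abs_le_sqrt_sum[OF assms(1)] by (simp add: S_def)
  \<comment> \<open>The conjugate expression to \<open>z\<close>, with \<open>r\<close> and
    \<open>S\<close> exchanged. Its square is the radicand, and being nonnegative it is the
    root.\<close>
  define y where "y = ((E + 1) * S - (E - 1) * r) / (2 * E)"
  have zeq: "z = ((E + 1) * r - (E - 1) * S) / (2 * E)"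
    using assms(2) by (simp add: z_def smooth_min_def flip: S_def) (simp add: field_simps)
  have \<sigma>: "\<sigma> = S\<^sup>2 - r\<^sup>2" using S2 by simp
  have "z\<^sup>2 + \<sigma> / E = y\<^sup>2"
    using assms(2) unfolding zeq y_def \<sigma> by (simp add: field_simps power2_eq_square)
  moreover have "0 \<le> y"
  proof -
    have "(E - 1) * r \<le> (E - 1) * S" using assms(2) S by (intro mult_left_mono) auto
    also have "\<dots> \<le> (E + 1) * S" using S by (intro mult_right_mono) auto
    finally show ?thesis using assms(2) by (simp add: y_def)
  qed
  ultimately have y: "sqrt (z\<^sup>2 + \<sigma> / E) = y" by simp
  show ?thesis using assms(2) unfolding y unfolding zeq y_def by (simp add: field_simps)
qed

text \<open>Supplies \<open>gz\<close> and \<open>gt\<close> of \<open>csub_transform\<close> for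
  the inverse of \<open>smooth_min\<close>, with the time-dependent ratio \<open>E t\<close>
  satisfying \<open>E' = K E\<close>.\<close>

lemma smooth_min_gradient:
  fixes K N \<sigma> :: real
  assumes "0 < \<sigma>" "0 < N"
  defines "E \<equiv> \<lambda>t. N * exp (K * t)"
  defines "S \<equiv> \<lambda>z t. sqrt (z\<^sup>2 + \<sigma> / E t)"
  shows "GDERIV (\<lambda>(z, t). (E t + 1) / 2 * z + (E t - 1) / 2 * S z t) (z, t) :>
    ((E t + 1) / 2 + (E t - 1) / 2 * (z / S z t),
     K * E t / 2 * (z + S z t) - (E t - 1) / 2 * (K * (\<sigma> / E t) / (2 * S z t)))"
proof -
  let ?z = "(z, t)"
  have pos: "0 < z\<^sup>2 + \<sigma> / E t" using assms(1,2) by (intro add_nonneg_pos) (auto simp: E_def)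
  have z: "GDERIV fst ?z :> (1, 0)" and t: "GDERIV snd ?z :> (0, 1)"
    unfolding gderiv_def by (auto intro!: derivative_eq_intros simp: inner_prod_def)
  have dE: "(E has_real_derivative K * E t) (at t)" unfolding E_def
    by (auto intro!: derivative_eq_intros)
  have E0: "E t \<noteq> 0" using assms(2) by (simp add: E_def)
  have dE': "((\<lambda>t. \<sigma> / E t) has_real_derivative - (K * (\<sigma> / E t))) (at t)"
    using E0 by (auto intro!: derivative_eq_intros dE simp: power2_eq_square)
  have "((\<lambda>t. (E t + 1) / 2) has_real_derivative K * E t / 2) (at (snd ?z))"
    "((\<lambda>t. (E t - 1) / 2) has_real_derivative K * E t / 2) (at (snd ?z))"
    by (auto intro!: derivative_eq_intros dE)
  note ab = this[THEN GDERIV_DERIV_compose[OF t]]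
  have "((\<lambda>z. z\<^sup>2) has_real_derivative 2 * z) (at (fst ?z))" by (auto intro!: derivative_eq_intros)
  from GDERIV_DERIV_compose[OF z this] dE'
  have q: "GDERIV (\<lambda>p. (fst p)\<^sup>2 + \<sigma> / E (snd p)) ?z :> (2 * z) *\<^sub>R (1, 0) + (- (K * (\<sigma> / E t))) *\<^sub>R (0, 1)"
    by (intro GDERIV_add GDERIV_DERIV_compose[OF t]) auto
  have "(sqrt has_real_derivative inverse (S z t) / 2) (at ((fst ?z)\<^sup>2 + \<sigma> / E (snd ?z)))"
    using DERIV_real_sqrt[OF pos] by (simp add: S_def)
  from GDERIV_DERIV_compose[OF q this]
  have s: "GDERIV (\<lambda>p. S (fst p) (snd p)) ?z :>
      (inverse (S z t) / 2) *\<^sub>R ((2 * z) *\<^sub>R (1, 0) + (- (K * (\<sigma> / E t))) *\<^sub>R (0, 1))"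
    by (simp add: S_def)
  have S0: "S z t \<noteq> 0" using pos by (simp add: S_def)
  have eq: "(\<lambda>(z, t). (E t + 1) / 2 * z + (E t - 1) / 2 * S z t)
      = (\<lambda>p. (E (snd p) + 1) / 2 * fst p + (E (snd p) - 1) / 2 * S (fst p) (snd p))"
    by auto
  show ?thesis
    unfolding eq
    by (rule GDERIV_subst[OF GDERIV_add[OF GDERIV_mult[OF ab(1) z] GDERIV_mult[OF ab(2) s]]])
       (use S0 in \<open>simp add: field_simps\<close>)
qed

text \<open>This is \<open>K * max z 0 * gz \<le> gt\<close> for the gradient above. Apart from the
  factor \<open>K\<close>, the difference of the sides is a quotient by \<open>4 * S\<close> whose
  numerator is a sum or product of nonnegative terms; the factorisation depends on the sign of
  \<open>z\<close>.\<close>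

lemma smooth_min_time_ineq:
  fixes z S s E K :: real
  assumes S: "0 < S" "S\<^sup>2 = z\<^sup>2 + s" and "0 \<le> s" "1 \<le> E" "0 \<le> K"
  shows "K * max z 0 * ((E + 1) / 2 + (E - 1) / 2 * (z / S))
    \<le> K * E / 2 * (z + S) - (E - 1) / 2 * (K * s / (2 * S))"
proof -
  have s: "s = S\<^sup>2 - z\<^sup>2" using S by simp
  have zS: "\<bar>z\<bar> \<le> S" using S assms(3) abs_le_square_iff[of z S] by simp
  have "max z 0 * ((E + 1) / 2 + (E - 1) / 2 * (z / S)) \<le> E / 2 * (z + S) - (E - 1) / 2 * (s / (2 * S))"
  proof (cases "0 \<le> z")
    case True
    have "0 \<le> (S - z)\<^sup>2 + E * ((S - z) * (S + z))" using True zS assms by (intro add_nonneg_nonneg mult_nonneg_nonneg) auto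
    then have "0 \<le> ((S - z)\<^sup>2 + E * ((S - z) * (S + z))) / (4 * S)" using S by simp
    also have "\<dots> = E / 2 * (z + S) - (E - 1) / 2 * (s / (2 * S)) - z * ((E + 1) / 2 + (E - 1) / 2 * (z / S))"
      using S(1) unfolding s by (simp add: field_simps power2_eq_square)
    finally show ?thesis using True by simp
  next
    case False
    have "(E - 1) * (S - z) \<le> (E - 1) * (2 * S)" using zS assms by (intro mult_left_mono) auto
    also have "\<dots> \<le> 2 * E * S" using S by (simp add: algebra_simps)
    finally have "0 \<le> (S + z) * (2 * E * S - (E - 1) * (S - z))" using zS by (intro mult_nonneg_nonneg) auto
    then have "0 \<le> (S + z) * (2 * E * S - (E - 1) * (S - z)) / (4 * S)" using S by simp
    also have "\<dots> = E / 2 * (z + S) - (E - 1) / 2 * (s / (2 * S))"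
      using S(1) unfolding s by (simp add: field_simps power2_eq_square)
    finally show ?thesis using False by simp
  qed
  from mult_left_mono[OF this \<open>0 \<le> K\<close>] show ?thesis by (simp add: algebra_simps)
qed

lemma mono_add_sqrt:
  fixes c :: real assumes "0 \<le> c" shows "mono (\<lambda>z. z + sqrt (z\<^sup>2 + c))"
proof (rule monoI)
  fix z z' :: real assume "z \<le> z'"
  define S where "S = sqrt (z'\<^sup>2 + c)"
  have S: "S\<^sup>2 = z'\<^sup>2 + c" "\<bar>z'\<bar> \<le> S" using assms abs_le_sqrt_sum by (auto simp: S_def)
  have "0 \<le> 2 * ((z' - z) * (z' + S))" using \<open>z \<le> z'\<close> S(2) by (intro mult_nonneg_nonneg) auto
  also have "\<dots> = (S + (z' - z))\<^sup>2 - (z\<^sup>2 + c)" using S(1) by (simp add: power2_eq_square algebra_simps)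
  finally have "sqrt (z\<^sup>2 + c) \<le> S + (z' - z)"
    using \<open>z \<le> z'\<close> S(2) by (intro real_le_lsqrt) auto
  then show "z + sqrt (z\<^sup>2 + c) \<le> z' + sqrt (z'\<^sup>2 + c)" by (simp add: S_def)
qed

text \<open>By homogeneity the factor \<open>gz\<close> passes through \<open>H\<close>, so only the
  time derivative of the transformation matters, and \<open>smooth_min_time_ineq\<close> turns it
  into the term \<open>K * max r 0\<close>. For \<open>K = 0\<close> the transformation is static
  and the equation is preserved.\<close>

lemma csub_smooth_min:
  assumes w: "csub T (\<lambda>x t r p. H x t p) w"
    and hom: "\<And>l x t p. 0 < l \<Longrightarrow> 0 < t \<Longrightarrow> t < T \<Longrightarrow> H x t (l *\<^sub>R p) = l * H x t p"
    and "0 < \<sigma>" "1 \<le> N" "0 \<le> K"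
  shows "csub T (\<lambda>x t r p. H x t p - K * max r 0) (\<lambda>x t. smooth_min \<sigma> (N * exp (K * t)) (w x t))"
proof -
  define E where "E t = N * exp (K * t)" for t
  define S where "S z t = sqrt (z\<^sup>2 + \<sigma> / E t)" for z t
  have E1: "1 \<le> E t" if "0 < t" for t
    using that assms mult_mono[of 1 N 1 "exp (K * t)"] by (simp add: E_def)
  have E0: "0 < E t" for t using assms by (simp add: E_def)
  have En0: "E t \<noteq> 0" for t using E0[of t] by simp
  have c0: "0 < \<sigma> / E t" for t using assms E0 by simp
  have S0: "0 < S z t" for z t using c0 by (simp add: S_def add_nonneg_pos)
  have Sn0: "S z t \<noteq> 0" for z t using S0[of z t] by simp
  have S2: "(S z t)\<^sup>2 = z\<^sup>2 + \<sigma> / E t" for z t using c0[of t] by (simp add: S_def)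
  have zS: "\<bar>z\<bar> \<le> S z t" for z t using abs_le_sqrt_sum[OF less_imp_le[OF c0]] by (simp add: S_def)
  define g where "g z t = (E t + 1) / 2 * z + (E t - 1) / 2 * S z t" for z t
  define gz where "gz z t = (E t + 1) / 2 + (E t - 1) / 2 * (z / S z t)" for z t
  define gt where "gt z t = K * E t / 2 * (z + S z t) - (E t - 1) / 2 * (K * (\<sigma> / E t) / (2 * S z t))" for z t
  have contE: "continuous_on A E" for A unfolding E_def by (intro continuous_intros)
  have contE2: "continuous_on A (\<lambda>p. E (snd p))" for A :: "(real \<times> real) set"
    by (rule continuous_on_compose2[OF contE[of UNIV]]) (auto intro: continuous_intros)
  have contS: "continuous_on A (\<lambda>p. S (fst p) (snd p))" for A
    unfolding S_def by (intro continuous_intros contE2) (simp add: En0)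
  have gz0: "0 < gz z t" if "0 < t" for z t
  proof -
    have "- 1 \<le> z / S z t" using zS[of z t] S0[of z t] by (simp add: le_divide_eq)
    from mult_left_mono[OF this, of "(E t - 1) / 2"] show ?thesis
      using E1[OF that] by (simp add: gz_def field_simps)
  qed
  show ?thesis
  proof (rule csub_transform[OF w, of g gz gt])
    show "GDERIV (\<lambda>(z, t). g z t) (z, t) :> (gz z t, gt z t)" for z t
      using smooth_min_gradient[of \<sigma> N K z t] assms
      unfolding g_def gz_def gt_def S_def E_def by simp
    show "continuous_on (UNIV \<times> {0<..<T}) (\<lambda>(z, t). gz z t)"
      unfolding gz_def case_prod_beta
      by (intro continuous_intros contE2 contS) (simp_all add: Sn0)
    show "continuous_on (UNIV \<times> {0<..<T}) (\<lambda>(z, t). gt z t)"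
      unfolding gt_def case_prod_beta
      by (intro continuous_intros contE2 contS) (simp_all add: Sn0 En0)
    show "mono (\<lambda>z. g z t)" if "0 < t" for t
    proof (rule monoI)
      fix z z' :: real assume le: "z \<le> z'"
      have "(E t - 1) / 2 * (z + S z t) \<le> (E t - 1) / 2 * (z' + S z' t)"
        using monoD[OF mono_add_sqrt[OF less_imp_le[OF c0[of t]]] le] E1[OF that]
        by (intro mult_left_mono) (auto simp: S_def)
      then show "g z t \<le> g z' t" using le by (simp add: g_def field_simps)
    qed
    show "0 < gz z t" if "0 < t" for z t by (rule gz0[OF that])
    show "g (smooth_min \<sigma> (N * exp (K * t)) (w x t)) t = w x t" if "0 < t" for x t
      using smooth_min_inverse[of \<sigma> "E t" "w x t"] assms E1[OF that] by (simp add: g_def S_def E_def)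
    show "H x t (gz r t *\<^sub>R p) \<le> gt r t + gz r t * (H x t p - K * max r 0)" if "0 < t" "t < T" for x t r p
    proof -
      have "K * max r 0 * gz r t \<le> gt r t"
        using smooth_min_time_ineq[OF S0 S2 less_imp_le[OF c0] E1[OF that(1)] \<open>0 \<le> K\<close>] by (simp add: gz_def gt_def)
      then show ?thesis using hom[OF gz0[OF that(1)] that] by (simp add: algebra_simps)
    qed
  qed
qed

text \<open>The factor contributes \<open>- K * r\<close>, and
  \<open>max r 0 - r = max (- r) 0\<close>. The new zero-order term is nonincreasing in
  \<open>r\<close>, as the comparison argument requires.\<close>

lemma csub_exp_scale:
  assumes u: "csub T (\<lambda>x t r p. H x t p + K * max r 0) u"
    and hom: "\<And>l x t p. 0 < l \<Longrightarrow> 0 < t \<Longrightarrow> t < T \<Longrightarrow> H x t (l *\<^sub>R p) = l * H x t p"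
  shows "csub T (\<lambda>x t r p. H x t p + K * max (- r) 0) (\<lambda>x t. exp (- (K * t)) * u x t)"
proof (rule csub_transform[OF u, of "\<lambda>z t. exp (K * t) * z" "\<lambda>z t. exp (K * t)" "\<lambda>z t. K * exp (K * t) * z"])
  show "GDERIV (\<lambda>(z, t). exp (K * t) * z) (z, t) :> (exp (K * t), K * exp (K * t) * z)" for z t :: real
  proof -
    have z: "GDERIV fst (z, t) :> (1::real, 0::real)" and t: "GDERIV snd (z, t) :> (0::real, 1::real)"
      unfolding gderiv_def by (auto intro!: derivative_eq_intros simp: inner_prod_def)
    have "((\<lambda>t. exp (K * t)) has_real_derivative K * exp (K * t)) (at (snd (z, t)))"
      by (auto intro!: derivative_eq_intros)
    from GDERIV_mult[OF GDERIV_DERIV_compose[OF t this] z] show ?thesis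
      unfolding case_prod_beta by (rule GDERIV_subst) simp
  qed
  show "mono (\<lambda>z. exp (K * t) * z)" for t by (auto intro!: monoI)
  show "exp (K * t) * (exp (- (K * t)) * u x t) = u x t" for x t
    by (simp add: exp_minus)
  show "H x t (exp (K * t) *\<^sub>R p) + K * max (exp (K * t) * r) 0
      \<le> K * exp (K * t) * r + exp (K * t) * (H x t p + K * max (- r) 0)" if "0 < t" "t < T" for x t r p
  proof -
    have "max (exp (K * t) * r) 0 = exp (K * t) * max r 0" by (simp add: max_mult_distrib_left)
    moreover have "max r 0 = r + max (- r) 0" by auto
    ultimately show ?thesis using hom[OF _ that, of "exp (K * t)"] by (simp add: algebra_simps)
  qed
qed (auto simp: case_prod_beta intro!: continuous_intros)

lemma csub_scale:
  assumes u: "csub T (\<lambda>x t r p. H x t p) u" and N: "0 < N"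
    and hom: "\<And>l x t p. 0 < l \<Longrightarrow> 0 < t \<Longrightarrow> t < T \<Longrightarrow> H x t (l *\<^sub>R p) = l * H x t p"
  shows "csub T (\<lambda>x t r p. H x t p) (\<lambda>x t. N * u x t)"
proof (rule csub_transform[OF u, of "\<lambda>z t. z / N" "\<lambda>z t. 1 / N" "\<lambda>z t. 0"])
  show "GDERIV (\<lambda>(z, t). z / N) (z, t) :> (1 / N, 0)" for z t :: real
    unfolding gderiv_def case_prod_beta divide_inverse by (auto intro!: derivative_eq_intros simp: inner_prod_def)
  show "mono (\<lambda>z. z / N)" using N by (auto intro!: monoI divide_right_mono)
  show "H x t ((1 / N) *\<^sub>R p) \<le> 0 + 1 / N * H x t p" if "0 < t" "t < T" for x t p
    using hom[OF _ that, of "1 / N"] N by simp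
qed (use N in \<open>auto simp: case_prod_beta\<close>)

subsection \<open>Comparison for geometric Hamiltonians\<close>

text \<open>The Lipschitz bound in \<open>x\<close> is stated for all \<open>p\<close> with the
  factor \<open>norm p\<close>; this is the bound on the unit sphere extended by
  homogeneity.\<close>

locale geometric_hamiltonian =
  fixes T :: real and H :: "'a::euclidean_space \<Rightarrow> real \<Rightarrow> 'a \<Rightarrow> real" and L1 L2 :: real
  assumes T_pos: "0 < T" and L1_pos: "0 < L1" and L2_pos: "0 < L2"
    and cont: "continuous_on (UNIV \<times> {0..T} \<times> UNIV) (\<lambda>(x, t, p). H x t p)"
    and homogeneous: "\<And>l x t p. 0 < l \<Longrightarrow> 0 \<le> t \<Longrightarrow> t \<le> T \<Longrightarrow> H x t (l *\<^sub>R p) = l * H x t p"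
    and lipschitz_x: "\<And>x y t p. 0 \<le> t \<Longrightarrow> t \<le> T \<Longrightarrow> \<bar>H x t p - H y t p\<bar> \<le> L1 * norm (x - y) * norm p"
    and lipschitz_p: "\<And>x t p q. 0 \<le> t \<Longrightarrow> t \<le> T \<Longrightarrow> \<bar>H x t p - H x t q\<bar> \<le> L2 * norm (p - q)"
begin

text \<open>The reflected Hamiltonian governs the negatives of solutions, so every one-sided result
  holds for the other side as well.\<close>

lemma reflected: "geometric_hamiltonian T (\<lambda>x t p. - H x t (- p)) L1 L2"
proof
  show "continuous_on (UNIV \<times> {0..T} \<times> UNIV) (\<lambda>(x, t, p). - H x t (- p))"
  proof -
    have "continuous_on (UNIV \<times> {0..T} \<times> UNIV) (\<lambda>z::'a \<times> real \<times> 'a. (fst z, fst (snd z), - snd (snd z)))"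
      by (intro continuous_intros)
    from continuous_on_compose2[OF cont this]
    have "continuous_on (UNIV \<times> {0..T} \<times> UNIV) (\<lambda>z::'a \<times> real \<times> 'a. H (fst z) (fst (snd z)) (- snd (snd z)))"
      by (fastforce simp: case_prod_beta)
    from continuous_on_minus[OF this] show ?thesis by (simp add: case_prod_beta)
  qed
  show "- H x t (- (l *\<^sub>R p)) = l * - H x t (- p)" if "0 < l" "0 \<le> t" "t \<le> T" for l x t p
    using homogeneous[OF that, of x "- p"] by simp
  show "\<bar>- H x t (- p) - - H y t (- p)\<bar> \<le> L1 * norm (x - y) * norm p" if "0 \<le> t" "t \<le> T" for x y t p
    using lipschitz_x[OF that, of x "- p" y] by simp
  show "\<bar>- H x t (- p) - - H x t (- q)\<bar> \<le> L2 * norm (p - q)" if "0 \<le> t" "t \<le> T" for x t p q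
    using lipschitz_p[OF that, of x "- p" "- q"] by (simp add: norm_minus_commute)
qed (rule T_pos L1_pos L2_pos)+

lemma cont4: "continuous_on (UNIV \<times> {0<..<T} \<times> UNIV \<times> UNIV) (\<lambda>(x, t, r::real, p). H x t p)"
proof -
  have "continuous_on (UNIV \<times> {0<..<T} \<times> UNIV \<times> UNIV)
      (\<lambda>z::'a \<times> real \<times> real \<times> 'a. (fst z, fst (snd z), snd (snd (snd z))))"
    by (intro continuous_intros)
  moreover have "(\<lambda>z::'a \<times> real \<times> real \<times> 'a. (fst z, fst (snd z), snd (snd (snd z))))
      ` (UNIV \<times> {0<..<T} \<times> UNIV \<times> UNIV) \<subseteq> UNIV \<times> {0..T} \<times> UNIV"
    by auto
  ultimately show ?thesis using continuous_on_compose2[OF cont] by (fastforce simp: case_prod_beta)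
qed

text \<open>The two errors of the doubling argument: the perturbed gradient costs
  \<open>L2 * \<alpha>\<close>, whence the choice \<open>\<Lambda> = L2\<close>, and the shift of
  the base point costs a term that the exponential weight has to absorb.\<close>

lemma doubled_bound:
  assumes "0 < t" "t < T" "norm q \<le> 1" "0 \<le> \<alpha>"
  shows "H x t (p + \<alpha> *\<^sub>R q) - H y t p \<le> L2 * \<alpha> + L1 * norm (x - y) * norm p"
proof -
  have "\<bar>H x t (p + \<alpha> *\<^sub>R q) - H x t p\<bar> \<le> L2 * norm (\<alpha> *\<^sub>R q)"
    using lipschitz_p[of t x "p + \<alpha> *\<^sub>R q" p] assms by simp
  also have "\<dots> \<le> L2 * \<alpha>" using assms L2_pos by (simp add: mult_left_le)
  finally show ?thesis using lipschitz_x[of t x p y] assms by auto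
qed

text \<open>A positive excess over the cone leads, by doubling, to a point off the diagonal where
  the gradient is long enough to annihilate \<open>R\<close>. There the weight with rate
  \<open>L1\<close> matches the error from the shift of \<open>x\<close> exactly, a
  contradiction.\<close>

lemma cone_comparison:
  assumes u: "csub T (\<lambda>x t r p. H x t p + R x t r p) u" and v: "csub T (\<lambda>x t r p. - H x t (- p)) v"
    and contu: "continuous_on (UNIV \<times> {0..<T}) (\<lambda>(x, t). u x t)"
    and contv: "continuous_on (UNIV \<times> {0..<T}) (\<lambda>(x, t). v x t)"
    and contR: "continuous_on (UNIV \<times> {0<..<T} \<times> UNIV \<times> UNIV) (\<lambda>(x, t, r, p). R x t r p)"
    and R0: "\<And>x t r p. 1 \<le> norm p \<Longrightarrow> R x t r p = 0"
    and growth: "\<And>x y t. 0 \<le> t \<Longrightarrow> t < T \<Longrightarrow> u x t + v y t \<le> C + L * norm (x - y)"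
    and init: "\<And>x y. u x 0 + v y 0 \<le> L * norm (x - y)"
    and diag: "\<And>x t. 0 < t \<Longrightarrow> t < T \<Longrightarrow> u x t + v x t \<le> 0"
    and M: "2 \<le> M" "L + 1 \<le> M" and t: "0 \<le> t1" "t1 < T"
  shows "u x1 t1 + v y1 t1 \<le> exp (L1 * t1) * (M * norm (x1 - y1))"
proof (rule ccontr)
  assume *: "\<not> ?thesis"
  have contF: "continuous_on (UNIV \<times> {0<..<T} \<times> UNIV \<times> UNIV) (\<lambda>(x, t, r, p). H x t p + R x t r p)"
    using continuous_on_add[OF cont4 contR] by (simp add: case_prod_beta)
  have contG: "continuous_on (UNIV \<times> {0<..<T} \<times> UNIV \<times> UNIV) (\<lambda>(x, t, r::real, p). - H x t (- p))"
    by (rule geometric_hamiltonian.cont4[OF reflected])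
  have e1: "1 \<le> exp (L1 * t)" if "0 \<le> t" for t using that L1_pos by simp
  have growth': "u x t + v y t - exp (L1 * t) * (M * norm (x - y)) \<le> C - norm (x - y)"
    if "0 \<le> t" "t < T" for x y t
  proof -
    have "L * norm (x - y) + norm (x - y) \<le> M * norm (x - y)"
      using mult_right_mono[OF M(2) norm_ge_zero[of "x - y"]] by (simp add: algebra_simps)
    moreover have "M * norm (x - y) \<le> exp (L1 * t) * (M * norm (x - y))"
      using mult_right_mono[OF e1[OF that(1)], of "M * norm (x - y)"] M by simp
    ultimately show ?thesis using growth[OF that, of x y] by linarith
  qed
  have init': "u x 0 + v y 0 \<le> M * norm (x - y)" for x y
    using init[of x y] mult_right_mono[of L M "norm (x - y)"] M by auto
  \<comment> \<open>As a function of \<open>s\<^sup>2\<close> the cone is concave, so it lies below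
    its tangent at \<open>r\<^sup>2\<close>, whose slope is \<open>M / (2 * r)\<close>.\<close>
  have mc: "M * s \<le> M * r + M / (2 * r) * (s\<^sup>2 - r\<^sup>2)" if "r \<in> {0<..}" for r s :: real
  proof -
    have "0 \<le> M / (2 * r) * (s - r)\<^sup>2" using M that by simp
    also have "\<dots> = M * r + M / (2 * r) * (s\<^sup>2 - r\<^sup>2) - M * s"
      using that by (simp add: field_simps power2_eq_square)
    finally show ?thesis by simp
  qed
  obtain x y t \<alpha> q where tt: "0 < t" "t < T" and \<alpha>: "0 < \<alpha>" "\<alpha> < 1" and q: "norm q \<le> 1"
    and pos: "exp (L1 * t) * (M * norm (x - y)) < u x t + v y t"
    and ineq: "L1 * exp (L1 * t) * (M * norm (x - y)) + L2 * \<alpha>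
      < (H x t ((2 * (M / (2 * norm (x - y))) * exp (L1 * t)) *\<^sub>R (x - y) + \<alpha> *\<^sub>R q)
          + R x t (u x t) ((2 * (M / (2 * norm (x - y))) * exp (L1 * t)) *\<^sub>R (x - y) + \<alpha> *\<^sub>R q))
        + - H y t (- (- ((2 * (M / (2 * norm (x - y))) * exp (L1 * t)) *\<^sub>R (x - y))))"
  proof (rule doubling[where D = "{0<..}" and m = "\<lambda>s. M * s" and c = "\<lambda>r. M / (2 * r)" and \<kappa> = L1,
        OF T_pos u v contu contv contF contG _ _ open_greaterThan mc growth' init' _ t _ L2_pos])
    show "norm (x - y) \<in> {0<..}" if "0 < t" "t < T" "exp (L1 * t) * (M * norm (x - y)) < u x t + v y t" for x y t
      using that diag[of t x] by (cases "x = y") auto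
    show "exp (L1 * t1) * (M * norm (x1 - y1)) < u x1 t1 + v y1 t1" using * by simp
  qed (auto intro!: continuous_intros)
  have ne: "x \<noteq> y" using pos diag[OF tt, of x] by auto
  define p where "p = (2 * (M / (2 * norm (x - y))) * exp (L1 * t)) *\<^sub>R (x - y)"
  have np: "norm p = M * exp (L1 * t)" using ne M by (simp add: p_def)
  \<comment> \<open>Slope at least 2 leaves room for a perturbation of length at most 1, so the
    perturbed gradient still has norm at least 1.\<close>
  have "2 * 1 \<le> M * exp (L1 * t)" using M e1[of t] tt by (intro mult_mono) auto
  then have "2 \<le> norm p" using np by simp
  moreover have "norm (\<alpha> *\<^sub>R q) \<le> 1" using \<alpha> q by (simp add: mult_le_one)
  moreover have "norm p \<le> norm (p + \<alpha> *\<^sub>R q) + norm (\<alpha> *\<^sub>R q)" by (metis add_diff_cancel_right' norm_triangle_ineq4)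
  ultimately have "R x t (u x t) (p + \<alpha> *\<^sub>R q) = 0" by (intro R0) linarith
  with ineq have "L1 * exp (L1 * t) * (M * norm (x - y)) + L2 * \<alpha> < H x t (p + \<alpha> *\<^sub>R q) - H y t p"
    unfolding p_def[symmetric] by simp
  also have "\<dots> \<le> L2 * \<alpha> + L1 * norm (x - y) * norm p" using doubled_bound tt q \<alpha> by simp
  finally show False by (simp add: np mult_ac)
qed

text \<open>Doubling with a steep paraboloid. Where \<open>u + v\<close> is positive,
  \<open>- u\<close> is below \<open>v\<close>, so the zero-order terms have the right sign. The
  bound on the diagonal vanishes with \<open>e\<close>.\<close>

lemma smooth_comparison:
  assumes u: "csub T (\<lambda>x t r p. H x t p + K * max (- r) 0) u"
    and v: "csub T (\<lambda>x t r p. - H x t (- p) - K * max r 0) v"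
    and contu: "continuous_on (UNIV \<times> {0..<T}) (\<lambda>(x, t). u x t)"
    and contv: "continuous_on (UNIV \<times> {0..<T}) (\<lambda>(x, t). v x t)"
    and K: "0 \<le> K" and L: "0 \<le> L"
    and growth: "\<And>x y t. 0 \<le> t \<Longrightarrow> t < T \<Longrightarrow> u x t + v y t \<le> C + L * norm (x - y)"
    and init: "\<And>x y. u x 0 + v y 0 \<le> L * norm (x - y)"
    and t: "0 \<le> t1" "t1 < T"
  shows "u x1 t1 + v x1 t1 \<le> 0"
proof -
  have bound: "u x1 t1 + v x1 t1 \<le> exp (2 * L1 * t1) * ((L + 1)\<^sup>2 * e)" if e: "0 < e" for e
  proof (rule ccontr)
    assume *: "\<not> ?thesis"
    \<comment> \<open>The constant lifts the paraboloid above the line of slope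
      \<open>L + 1\<close>: slope \<open>L\<close> handles the initial data, the extra 1 gives the
      decay in \<open>growth'\<close>.\<close>
    define m where "m s = s\<^sup>2 / e + (L + 1)\<^sup>2 * e" for s
    have m: "(L + 1) * s \<le> m s" "0 \<le> m s" for s
    proof -
      have "m s - (L + 1) * s = ((s - (L + 1) * e)\<^sup>2 + (s + 0)\<^sup>2 + ((L+1) * e)\<^sup>2) / (2 * e)"
        using e by (simp add: m_def field_simps power2_eq_square)
      also have "\<dots> \<ge> 0" using e by simp
      finally show "(L + 1) * s \<le> m s" by simp
      show "0 \<le> m s" using e by (simp add: m_def)
    qed
    have contF: "continuous_on (UNIV \<times> {0<..<T} \<times> UNIV \<times> UNIV) (\<lambda>(x, t, r, p). H x t p + K * max (- r) 0)"
      unfolding case_prod_beta by (intro continuous_intros cont4[unfolded case_prod_beta])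
    have contG: "continuous_on (UNIV \<times> {0<..<T} \<times> UNIV \<times> UNIV) (\<lambda>(x, t, r, p). - H x t (- p) - K * max r 0)"
      unfolding case_prod_beta
      by (intro continuous_intros geometric_hamiltonian.cont4[OF reflected, unfolded case_prod_beta])
    have growth': "u x t + v y t - exp (2 * L1 * t) * m (norm (x - y)) \<le> C - norm (x - y)"
      if "0 \<le> t" "t < T" for x y t
    proof -
      have "1 \<le> exp (2 * L1 * t)" using L1_pos that by simp
      from mult_right_mono[OF this m(2)[of "norm (x - y)"]]
      have "L * norm (x - y) + norm (x - y) \<le> exp (2 * L1 * t) * m (norm (x - y))"
        using m(1)[of "norm (x - y)"] by (simp add: algebra_simps)
      then show ?thesis using growth[OF that, of x y] by linarith
    qed
    have init': "u x 0 + v y 0 \<le> m (norm (x - y))" for x y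
      using init[of x y] m(1)[of "norm (x - y)"] by (simp add: algebra_simps) (smt (verit) norm_ge_zero)
    \<comment> \<open>The rate is \<open>2 * L1\<close> since for the paraboloid the gradient length
      times the distance is twice the weighted quadratic part.\<close>
    obtain x y t \<alpha> q where tt: "0 < t" "t < T" and \<alpha>: "0 < \<alpha>" "\<alpha> < 1" and q: "norm q \<le> 1"
      and pos: "exp (2 * L1 * t) * m (norm (x - y)) < u x t + v y t"
      and ineq: "2 * L1 * exp (2 * L1 * t) * m (norm (x - y)) + L2 * \<alpha>
        < (H x t ((2 * (1 / e) * exp (2 * L1 * t)) *\<^sub>R (x - y) + \<alpha> *\<^sub>R q) + K * max (- u x t) 0)
          + (- H y t (- (- ((2 * (1 / e) * exp (2 * L1 * t)) *\<^sub>R (x - y)))) - K * max (v y t) 0)"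
    proof (rule doubling[where m = m and c = "\<lambda>_. 1 / e" and \<kappa> = "2 * L1",
          OF T_pos u v contu contv contF contG _ _ open_UNIV _ growth' init' _ t _ L2_pos])
      show "m s \<le> m r + 1 / e * (s\<^sup>2 - r\<^sup>2)" for r s using e by (simp add: m_def field_simps)
      show "exp (2 * L1 * t1) * m (norm (x1 - x1)) < u x1 t1 + v x1 t1" using * by (simp add: m_def)
    qed (auto simp: m_def[abs_def] divide_real_def intro!: continuous_intros)
    define p where "p = (2 * (1 / e) * exp (2 * L1 * t)) *\<^sub>R (x - y)"
    have np: "norm p = 2 / e * exp (2 * L1 * t) * norm (x - y)" using e by (simp add: p_def)
    have "0 < u x t + v y t" using pos m(2)[of "norm (x - y)"] by (smt (verit) exp_ge_zero mult_nonneg_nonneg)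
    then have "K * max (- u x t) 0 \<le> K * max (v y t) 0" using K by (intro mult_left_mono) auto
    with ineq have "2 * L1 * exp (2 * L1 * t) * m (norm (x - y)) + L2 * \<alpha> < H x t (p + \<alpha> *\<^sub>R q) - H y t p"
      unfolding p_def[symmetric] by simp
    also have "\<dots> \<le> L2 * \<alpha> + L1 * norm (x - y) * norm p" using doubled_bound tt q \<alpha> by simp
    finally have "2 * L1 * exp (2 * L1 * t) * m (norm (x - y)) < 2 * L1 * exp (2 * L1 * t) * ((norm (x - y))\<^sup>2 / e)"
      by (simp add: np power2_eq_square mult_ac)
    moreover have "0 < 2 * L1 * exp (2 * L1 * t)" using L1_pos by simp
    ultimately have "m (norm (x - y)) < (norm (x - y))\<^sup>2 / e" by (simp only: mult_less_cancel_left_pos)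
    then show False using e by (simp add: m_def) (smt (verit) mult_nonneg_nonneg zero_le_power2)
  qed
  show ?thesis
  proof (rule field_le_epsilon)
    fix e' :: real assume e': "0 < e'"
    define A where "A = exp (2 * L1 * t1) * (L + 1)\<^sup>2"
    have A: "0 < A" using L by (simp add: A_def)
    have "u x1 t1 + v x1 t1 \<le> A * (e' / A)"
      using bound[of "e' / A"] A e' unfolding A_def mult.assoc by simp
    then show "u x1 t1 + v x1 t1 \<le> 0 + e'" using A by simp
  qed
qed

end

subsection \<open>The approximating problems\<close>

text \<open>The data as they enter the estimates, in a form closed under reflection.
  \<open>B\<close> is a Lipschitz constant of \<open>\<beta>\<close> at 0. The bound
  \<open>C\<close> concerns \<open>w\<close> only; the one for \<open>u \<theta>\<close> may depend
  on \<open>\<theta>\<close>.\<close>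

locale level_set_approximation = geometric_hamiltonian T H L1 L2
  for T :: real and H :: "'a::euclidean_space \<Rightarrow> real \<Rightarrow> 'a \<Rightarrow> real" and L1 L2 :: real +
  fixes \<beta> :: "real \<Rightarrow> real" and h :: "'a \<Rightarrow> real" and u0 :: "'a \<Rightarrow> real" and w :: "'a \<Rightarrow> real \<Rightarrow> real"
    and u :: "real \<Rightarrow> 'a \<Rightarrow> real \<Rightarrow> real" and B L C :: real
  assumes beta_mono: "mono \<beta>" and beta_pos: "\<And>r. 0 < r \<Longrightarrow> 0 < \<beta> r"
    and beta_neg: "\<And>r. r < 0 \<Longrightarrow> \<beta> r < 0" and beta_linear: "\<And>r. \<bar>\<beta> r\<bar> \<le> B * \<bar>r\<bar>"
    and B_nonneg: "0 \<le> B" and beta_cont: "continuous_on UNIV \<beta>"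
    and h_cont: "continuous_on UNIV h" and h_pos: "\<And>p. norm p < 1 \<Longrightarrow> 0 < h p"
    and h_zero: "\<And>p. 1 \<le> norm p \<Longrightarrow> h p = 0"
    and L_nonneg: "0 \<le> L" and u0_lipschitz: "\<And>x y. \<bar>u0 x - u0 y\<bar> \<le> L * norm (x - y)"
    and w_sub: "csub T (\<lambda>x t r p. H x t p) w"
    and w_super: "csub T (\<lambda>x t r p. - H x t (- p)) (\<lambda>x t. - w x t)"
    and w_cont: "continuous_on (UNIV \<times> {0..<T}) (\<lambda>(x, t). w x t)"
    and w_init: "\<And>x. w x 0 = u0 x"
    and w_bound: "\<And>x t. 0 \<le> t \<Longrightarrow> t < T \<Longrightarrow> \<bar>w x t - u0 x\<bar> \<le> C"
    and u_sub: "\<And>\<theta>. 0 < \<theta> \<Longrightarrow> csub T (\<lambda>x t r p. H x t p + \<theta> * \<beta> r * h p) (u \<theta>)"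
    and u_super: "\<And>\<theta>. 0 < \<theta> \<Longrightarrow>
      csub T (\<lambda>x t r p. - H x t (- p) - \<theta> * \<beta> (- r) * h (- p)) (\<lambda>x t. - u \<theta> x t)"
    and u_cont: "\<And>\<theta>. 0 < \<theta> \<Longrightarrow> continuous_on (UNIV \<times> {0..<T}) (\<lambda>(x, t). u \<theta> x t)"
    and u_init: "\<And>\<theta> x. 0 < \<theta> \<Longrightarrow> u \<theta> x 0 = u0 x"
    and u_bound: "\<And>\<theta>. 0 < \<theta> \<Longrightarrow> \<exists>D. \<forall>x t. 0 \<le> t \<longrightarrow> t < T \<longrightarrow> \<bar>u \<theta> x t - u0 x\<bar> \<le> D"
begin

lemma reflected_approximation:
  "level_set_approximation T (\<lambda>x t p. - H x t (- p)) L1 L2 (\<lambda>r. - \<beta> (- r)) (\<lambda>p. h (- p)) (\<lambda>x. - u0 x)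
    (\<lambda>x t. - w x t) (\<lambda>\<theta> x t. - u \<theta> x t) B L C"
proof (intro level_set_approximation.intro reflected level_set_approximation_axioms.intro)
  show "mono (\<lambda>r. - \<beta> (- r))" using beta_mono by (auto simp: mono_def)
  show "\<bar>- \<beta> (- r)\<bar> \<le> B * \<bar>r\<bar>" for r using beta_linear[of "- r"] by simp
  show "continuous_on UNIV (\<lambda>r. - \<beta> (- r))"
    by (intro continuous_on_minus continuous_on_compose2[OF beta_cont]) (auto intro: continuous_intros)
  show "continuous_on UNIV (\<lambda>p. h (- p))"
    by (intro continuous_on_compose2[OF h_cont]) (auto intro: continuous_intros)
  show "\<bar>- u0 x - - u0 y\<bar> \<le> L * norm (x - y)" for x y using u0_lipschitz[of x y] by simp
  show "continuous_on (UNIV \<times> {0..<T}) (\<lambda>(x, t). - w x t)"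
    using continuous_on_minus[OF w_cont] by (simp add: case_prod_beta)
  show "continuous_on (UNIV \<times> {0..<T}) (\<lambda>(x, t). - u \<theta> x t)" if "0 < \<theta>" for \<theta>
    using continuous_on_minus[OF u_cont[OF that]] by (simp add: case_prod_beta)
  show "\<bar>- w x t - - u0 x\<bar> \<le> C" if "0 \<le> t" "t < T" for x t using w_bound[OF that, of x] by simp
  show "\<exists>D. \<forall>x t. 0 \<le> t \<longrightarrow> t < T \<longrightarrow> \<bar>- u \<theta> x t - - u0 x\<bar> \<le> D" if \<theta>: "0 < \<theta>" for \<theta>
  proof -
    obtain D where "\<And>x t. 0 \<le> t \<Longrightarrow> t < T \<Longrightarrow> \<bar>u \<theta> x t - u0 x\<bar> \<le> D" using u_bound[OF \<theta>] by blast
    then have "\<forall>x t. 0 \<le> t \<longrightarrow> t < T \<longrightarrow> \<bar>- u \<theta> x t - - u0 x\<bar> \<le> D" by (simp add: abs_minus_commute)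
    then show ?thesis by blast
  qed
  show "csub T (\<lambda>x t r p. - H x t (- p) + \<theta> * - \<beta> (- r) * h (- p)) (\<lambda>x t. - u \<theta> x t)" if "0 < \<theta>" for \<theta>
    using u_super[OF that] by simp
  show "csub T (\<lambda>x t r p. - (- H x t (- (- p))) - \<theta> * - \<beta> (- (- r)) * h (- (- p))) (\<lambda>x t. - (- u \<theta> x t))"
    if "0 < \<theta>" for \<theta>
    using u_sub[OF that] by simp
qed (use beta_pos beta_neg B_nonneg h_pos h_zero L_nonneg w_sub w_super w_init u_init in auto)

section \<open>Bounds on the reaction term\<close>

lemma h_nonneg: "0 \<le> h p"
  by (cases "norm p < 1") (auto simp: h_zero dest: h_pos)

lemma h_bounded: obtains M where "0 \<le> M" "\<And>p. h p \<le> M"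
proof -
  have "\<exists>p0\<in>cball 0 1. \<forall>p\<in>cball 0 1. h p \<le> h p0"
    by (rule continuous_attains_sup) (auto intro: continuous_on_subset[OF h_cont])
  then obtain p0 where p0: "\<And>p. p \<in> cball 0 1 \<Longrightarrow> h p \<le> h p0" by blast
  have "h p \<le> h p0" for p using p0[of p] h_zero[of p] h_nonneg[of p0] by (cases "norm p \<le> 1") auto
  then show thesis using that h_nonneg by blast
qed

text \<open>For \<open>r \<ge> 0\<close> linear growth of \<open>\<beta>\<close> and boundedness of
  \<open>h\<close> suffice; for \<open>r < 0\<close> the reaction is nonpositive. The constant grows
  with \<open>\<theta>\<close>.\<close>

lemma reaction_bound:
  assumes "0 < \<theta>"
  obtains K where "0 \<le> K" "\<And>r p. \<theta> * \<beta> r * h p \<le> K * max r 0"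
proof -
  obtain M where M: "0 \<le> M" "\<And>p. h p \<le> M" using h_bounded by blast
  have "\<theta> * \<beta> r * h p \<le> \<theta> * B * M * max r 0" for r p
  proof (cases "0 \<le> r")
    case True
    have "\<beta> r \<le> B * r" using beta_linear[of r] True by simp
    then have "\<theta> * \<beta> r * h p \<le> \<theta> * (B * r) * h p"
      using assms h_nonneg by (intro mult_right_mono mult_left_mono) auto
    also have "\<dots> \<le> \<theta> * (B * r) * M"
      using assms M True B_nonneg by (intro mult_left_mono) auto
    finally show ?thesis using True by (simp add: mult_ac)
  next
    case False
    then have "\<theta> * \<beta> r * h p \<le> 0"
      using beta_neg[of r] assms h_nonneg[of p] by (simp add: mult_nonneg_nonpos2 mult_nonneg_nonpos)
    then show ?thesis using False by simp
  qed
  then show thesis using that[of "\<theta> * B * M"] assms B_nonneg M by simp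
qed

section \<open>Comparison of the approximations with the level set solution\<close>

lemma w_growth:
  assumes "\<forall>x t. 0 \<le> t \<longrightarrow> t < T \<longrightarrow> \<bar>v x t - u0 x\<bar> \<le> D" "0 \<le> t" "t < T"
  shows "v x t - w y t \<le> D + C + L * norm (x - y)"
  using assms(1)[rule_format, OF assms(2,3), of x] w_bound[OF assms(2,3), of y] u0_lipschitz[of x y]
  by linarith

text \<open>After division by \<open>exp (K * t)\<close> the claim reads
  \<open>U \<le> max w (w / exp (K * t))\<close>. The smooth version of this maximum is
  \<open>- V\<close>, and \<open>smooth_comparison\<close> applies to \<open>U\<close> and
  \<open>V\<close>.\<close>

lemma upper_barrier:
  assumes \<theta>: "0 < \<theta>" and K: "0 \<le> K" "\<And>r p. \<theta> * \<beta> r * h p \<le> K * max r 0" and t: "0 \<le> t1" "t1 < T"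
  shows "u \<theta> x1 t1 \<le> max (w x1 t1) (exp (K * t1) * w x1 t1)"
proof -
  obtain D where D: "\<forall>x t. 0 \<le> t \<longrightarrow> t < T \<longrightarrow> \<bar>u \<theta> x t - u0 x\<bar> \<le> D" using u_bound[OF \<theta>] by blast
  define U where "U x t = exp (- (K * t)) * u \<theta> x t" for x t
  have "csub T (\<lambda>x t r p. H x t p + K * max r 0) (u \<theta>)"
    by (rule csub_mono[OF u_sub[OF \<theta>]]) (use K in auto)
  then have U: "csub T (\<lambda>x t r p. H x t p + K * max (- r) 0) U"
    unfolding U_def by (rule csub_exp_scale) (auto intro: homogeneous)
  have contU: "continuous_on (UNIV \<times> {0..<T}) (\<lambda>(x, t). U x t)"
    using u_cont[OF \<theta>] unfolding U_def case_prod_beta by (intro continuous_intros)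
  have E1: "1 \<le> exp (K * t)" if "0 \<le> t" for t using that K by simp
  have main: "U x1 t1 + smooth_min (e\<^sup>2) (exp (K * t1)) (- w x1 t1) \<le> 0" if e: "0 < e" for e
  proof -
    \<comment> \<open>The parameter \<open>e\<^sup>2\<close> makes the smoothing error
      \<open>e\<close>. At time 0 the ratio is 1 and the transformation is the identity, so
      \<open>V\<close> starts exactly at \<open>- u0\<close>.\<close>
    define V where "V x t = smooth_min (e\<^sup>2) (1 * exp (K * t)) (- w x t)" for x t
    have V: "csub T (\<lambda>x t r p. - H x t (- p) - K * max r 0) V"
      unfolding V_def
    proof (rule csub_smooth_min[OF w_super])
      show "- H x t (- (l *\<^sub>R p)) = l * - H x t (- p)" if "0 < l" "0 < t" "t < T" for l x t p
        using geometric_hamiltonian.homogeneous[OF reflected, of l t x p] that by simp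
    qed (use e K in auto)
    have contV: "continuous_on (UNIV \<times> {0..<T}) (\<lambda>(x, t). V x t)"
      using w_cont unfolding V_def smooth_min_def case_prod_beta by (intro continuous_intros) auto
    have growth: "U x t + V y t \<le> \<bar>D + C\<bar> + L * norm (x - y)" if t: "0 \<le> t" "t < T" for x y t
    proof -
      have "V y t \<le> - w y t / exp (K * t)"
        using smooth_min_le(2)[of "e\<^sup>2" "exp (K * t)" "- w y t"] E1[OF t(1)] by (simp add: V_def)
      then have "U x t + V y t \<le> exp (- (K * t)) * (u \<theta> x t - w y t)"
        unfolding U_def exp_minus by (simp add: divide_real_def algebra_simps)
      also have "\<dots> \<le> exp (- (K * t)) * (\<bar>D + C\<bar> + L * norm (x - y))"
        using w_growth[OF D t, of x y] by (intro mult_left_mono) auto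
      also have "\<dots> \<le> 1 * (\<bar>D + C\<bar> + L * norm (x - y))"
        using K t L_nonneg by (intro mult_right_mono) auto
      finally show ?thesis by simp
    qed
    have init: "U x 0 + V y 0 \<le> L * norm (x - y)" for x y
      using u0_lipschitz[of x y] by (simp add: U_def V_def w_init u_init[OF \<theta>])
    show ?thesis
      using smooth_comparison[OF U V contU contV K(1) L_nonneg growth init t, of x1] by (simp add: V_def)
  qed
  have "U x1 t1 \<le> max (w x1 t1) (w x1 t1 / exp (K * t1))"
  proof (rule field_le_epsilon)
    fix e :: real assume e: "0 < e"
    show "U x1 t1 \<le> max (w x1 t1) (w x1 t1 / exp (K * t1)) + e"
      using main[OF e] smooth_min_ge[of "e\<^sup>2" "exp (K * t1)" "- w x1 t1"] E1[OF t(1)] e by auto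
  qed
  then have "exp (K * t1) * U x1 t1 \<le> exp (K * t1) * max (w x1 t1) (w x1 t1 / exp (K * t1))"
    by (intro mult_left_mono) auto
  moreover have "exp (K * t1) * U x1 t1 = u \<theta> x1 t1"
    by (simp add: U_def exp_minus flip: mult.assoc)
  ultimately show ?thesis by (simp add: max_mult_distrib_left max.commute)
qed

text \<open>Although \<open>K\<close> depends on \<open>\<theta>\<close>, it enters only through
  \<open>V\<close>, a smooth version of \<open>- max w (N * w)\<close>. At a zero of
  \<open>w\<close> this is 0 up to the smoothing error, so the resulting bound is free of
  \<open>\<theta>\<close>.\<close>

lemma cone_bound:
  assumes \<theta>: "0 < \<theta>" and t: "0 \<le> t1" "t1 < T" and y: "w y1 t1 = 0"
  shows "u \<theta> x1 t1 \<le> exp (L1 * t1) * (max 2 (L + 1) * norm (x1 - y1))"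
proof -
  obtain K where K: "0 \<le> K" "\<And>r p. \<theta> * \<beta> r * h p \<le> K * max r 0" using reaction_bound[OF \<theta>] by blast
  obtain D where D: "\<forall>x t. 0 \<le> t \<longrightarrow> t < T \<longrightarrow> \<bar>u \<theta> x t - u0 x\<bar> \<le> D" using u_bound[OF \<theta>] by blast
  \<comment> \<open>A constant dominating \<open>exp (K * t)\<close> up to time \<open>T\<close>. A
    static transformation keeps \<open>V\<close> a subsolution without reaction term, as
    \<open>cone_comparison\<close> demands.\<close>
  define N where "N = exp (K * T)"
  have N: "1 \<le> N" using K T_pos by (simp add: N_def)
  have hom: "- H x t (- (l *\<^sub>R p)) = l * - H x t (- p)" if "0 < l" "0 < t" "t < T" for l x t p
    using geometric_hamiltonian.homogeneous[OF reflected, of l t x p] that by simp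
  have main: "u \<theta> x1 t1 + N * smooth_min (e\<^sup>2) N (- w y1 t1) \<le> exp (L1 * t1) * (max 2 (L + 1) * norm (x1 - y1))"
    if e: "0 < e" for e
  proof -
    define V where "V x t = N * smooth_min (e\<^sup>2) N (- w x t)" for x t
    have Vle: "V x t \<le> N * - w x t" "V x t \<le> - w x t" for x t
      using mult_left_mono[OF smooth_min_le(1)[of "e\<^sup>2" N "- w x t"], of N]
        smooth_min_le(2)[of "e\<^sup>2" N "- w x t"] N by (auto simp: V_def field_simps)
    have "csub T (\<lambda>x t r p. - H x t (- p) - 0 * max r 0) (\<lambda>x t. smooth_min (e\<^sup>2) (N * exp (0 * t)) (- w x t))"
      by (rule csub_smooth_min[OF w_super hom]) (use e N in auto)
    then have "csub T (\<lambda>x t r p. - H x t (- p)) (\<lambda>x t. smooth_min (e\<^sup>2) N (- w x t))" by simp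
    then have V: "csub T (\<lambda>x t r p. - H x t (- p)) V"
      unfolding V_def by (rule csub_scale[OF _ _ hom]) (use N in auto)
    have contV: "continuous_on (UNIV \<times> {0..<T}) (\<lambda>(x, t). V x t)"
      using w_cont N unfolding V_def smooth_min_def case_prod_beta by (intro continuous_intros) auto
    have contR: "continuous_on (UNIV \<times> {0<..<T} \<times> UNIV \<times> UNIV) (\<lambda>(x, t, r, p). \<theta> * \<beta> r * h p)"
      unfolding case_prod_beta
      by (intro continuous_intros continuous_on_compose2[OF beta_cont] continuous_on_compose2[OF h_cont]) auto
    have "u \<theta> x1 t1 + V y1 t1 \<le> exp (L1 * t1) * (max 2 (L + 1) * norm (x1 - y1))"
    proof (rule cone_comparison[OF u_sub[OF \<theta>] V u_cont[OF \<theta>] contV contR _ _ _ _ _ _ t])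
      show "u \<theta> x t + V y t \<le> D + C + L * norm (x - y)" if "0 \<le> t" "t < T" for x y t
        using w_growth[OF D that, of x y] Vle(2)[of y t] by simp
      show "u \<theta> x 0 + V y 0 \<le> L * norm (x - y)" for x y
        using u0_lipschitz[of x y] Vle(2)[of y 0] by (simp add: w_init u_init[OF \<theta>])
      \<comment> \<open>On the diagonal, \<open>u \<theta> \<le> max w (exp (K * t) * w) \<le> max w
        (N * w) \<le> - V\<close>.\<close>
      show "u \<theta> x t + V x t \<le> 0" if "0 < t" "t < T" for x t
      proof -
        have "exp (K * t) \<le> N" using K that by (simp add: N_def mult_left_mono)
        then have "0 \<le> w x t \<Longrightarrow> exp (K * t) * w x t \<le> N * w x t" by (rule mult_right_mono)
        moreover have "w x t \<le> 0 \<Longrightarrow> exp (K * t) * w x t \<le> w x t"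
          using K that mult_right_mono_neg[of 1 "exp (K * t)" "w x t"] by simp
        moreover have "0 \<le> w x t \<Longrightarrow> w x t \<le> N * w x t" using N by (simp add: mult_le_cancel_right1)
        ultimately show ?thesis
          using upper_barrier[OF \<theta> K, of t x] that Vle[of x t] by (cases "0 \<le> w x t") auto
      qed
    qed (use h_zero in auto)
    then show ?thesis by (simp add: V_def)
  qed
  show ?thesis
  proof (rule field_le_epsilon)
    fix e :: real assume e: "0 < e"
    \<comment> \<open>The factor \<open>N\<close> in \<open>V\<close> multiplies the smoothing
      error, which is therefore taken as \<open>e / N\<close>.\<close>
    have "- (e / N) \<le> smooth_min ((e / N)\<^sup>2) N 0"
      using smooth_min_ge[of "(e / N)\<^sup>2" N 0] N e by simp
    then have "- e \<le> N * smooth_min ((e / N)\<^sup>2) N 0" using N by (simp add: field_simps)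
    then show "u \<theta> x1 t1 \<le> exp (L1 * t1) * (max 2 (L + 1) * norm (x1 - y1)) + e"
      using main[of "e / N"] N e y by simp
  qed
qed

text \<open>The upper barrier of the reflected problem bounds \<open>- u \<theta>\<close> by
  \<open>max (- w) (- exp (K * t) * w)\<close>, which is \<open>- w\<close> where
  \<open>w \<ge> 0\<close>.\<close>

lemma lower_barrier:
  assumes \<theta>: "0 < \<theta>" and t: "0 \<le> t1" "t1 < T" and w: "0 \<le> w x1 t1"
  shows "w x1 t1 \<le> u \<theta> x1 t1"
proof -
  interpret r: level_set_approximation T "\<lambda>x t p. - H x t (- p)" L1 L2 "\<lambda>r. - \<beta> (- r)" "\<lambda>p. h (- p)"
    "\<lambda>x. - u0 x" "\<lambda>x t. - w x t" "\<lambda>\<theta> x t. - u \<theta> x t" B L C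
    by (rule reflected_approximation)
  obtain K where K: "0 \<le> K" "\<And>r p. \<theta> * - \<beta> (- r) * h (- p) \<le> K * max r 0" using r.reaction_bound[OF \<theta>] by blast
  have "w x1 t1 \<le> exp (K * t1) * w x1 t1"
    using mult_right_mono[of 1 "exp (K * t1)" "w x1 t1"] K t w by simp
  then show ?thesis using r.upper_barrier[OF \<theta> K t, of x1] by simp
qed


text \<open>The ball is connected and misses the zero level, so \<open>w\<close> is positive on it
  at time \<open>t0\<close>. Compactness extends this to nearby times and yields a positive
  minimum.\<close>

lemma w_positive_cylinder:
  assumes t0: "0 < t0" "t0 < T" and w: "0 < w x0 t0" and \<rho>: "0 \<le> \<rho>" "\<rho> < infdist x0 (zero_level w t0)"
  obtains \<delta> \<eta> where "0 < \<delta>" "\<delta> < t0" "t0 + \<delta> < T" "0 < \<eta>"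
    "\<And>x t. dist x0 x \<le> \<rho> \<Longrightarrow> \<bar>t - t0\<bar> \<le> \<delta> \<Longrightarrow> \<eta> \<le> w x t"
proof -
  define d where "d = min t0 (T - t0) / 2"
  have d: "0 < d" "d < t0" "t0 + d < T" using t0 by (auto simp: d_def min_def field_simps)
  have cont: "continuous_on (cball x0 \<rho> \<times> {t0 - d..t0 + d}) (\<lambda>(x, t). w x t)"
    by (rule continuous_on_subset[OF w_cont]) (use d in auto)
  have ball: "0 < w x t0" if x: "x \<in> cball x0 \<rho>" for x
  proof (rule ccontr)
    assume npos: "\<not> 0 < w x t0"
    have "continuous_on (cball x0 \<rho>) (\<lambda>x. w x t0)"
      by (rule continuous_on_compose_curried2[OF cont]) (use d in \<open>auto intro: continuous_intros\<close>)
    then have "connected ((\<lambda>x. w x t0) ` cball x0 \<rho>)" by (intro connected_continuous_image) auto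
    moreover have "w x t0 \<in> (\<lambda>x. w x t0) ` cball x0 \<rho>" "w x0 t0 \<in> (\<lambda>x. w x t0) ` cball x0 \<rho>"
      using x \<rho> by auto
    ultimately have "0 \<in> (\<lambda>x. w x t0) ` cball x0 \<rho>"
      using npos w by (meson connectedD_interval less_imp_le not_less)
    then obtain z where "z \<in> cball x0 \<rho>" "z \<in> zero_level w t0" by (auto simp: zero_level_def)
    then show False using infdist_le[of z "zero_level w t0" x0] \<rho> by auto
  qed
  \<comment> \<open>The points with \<open>w \<le> 0\<close> form a compact set without points at
    time \<open>t0\<close>. Half of its least time distance from \<open>t0\<close>, capped by
    \<open>d\<close>, is an admissible \<open>\<delta>\<close>.\<close>
  define A where "A = {z \<in> cball x0 \<rho> \<times> {t0 - d..t0 + d}. (case z of (x, t) \<Rightarrow> w x t) \<in> {..0}}"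
  have S: "compact (cball x0 \<rho> \<times> {t0 - d..t0 + d})" by (intro compact_Times) auto
  have "A = (cball x0 \<rho> \<times> {t0 - d..t0 + d})
      \<inter> ((cball x0 \<rho> \<times> {t0 - d..t0 + d}) \<inter> (\<lambda>(x, t). w x t) -` {..0})"
    by (auto simp: A_def)
  then have A: "compact A"
    using compact_Int_closed[OF S continuous_closed_preimage[OF cont compact_imp_closed[OF S]]] by simp
  obtain \<delta> where \<delta>: "0 < \<delta>" "\<delta> \<le> d" "\<And>x t. x \<in> cball x0 \<rho> \<Longrightarrow> \<bar>t - t0\<bar> \<le> \<delta> \<Longrightarrow> 0 < w x t"
  proof (cases "A = {}")
    case True
    show thesis
    proof (rule that[of d])
      fix x t assume "x \<in> cball x0 \<rho>" "\<bar>t - t0\<bar> \<le> d"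
      then have "(x, t) \<in> cball x0 \<rho> \<times> {t0 - d..t0 + d}" by auto
      then show "0 < w x t" using True by (force simp: A_def)
    qed (use d in auto)
  next
    case False
    have "\<exists>z\<in>A. \<forall>z'\<in>A. \<bar>snd z - t0\<bar> \<le> \<bar>snd z' - t0\<bar>"
      by (rule continuous_attains_inf[OF A False]) (intro continuous_intros)
    then obtain z where z: "z \<in> A" "\<And>z'. z' \<in> A \<Longrightarrow> \<bar>snd z - t0\<bar> \<le> \<bar>snd z' - t0\<bar>" by blast
    have "snd z \<noteq> t0" using z(1) ball by (force simp: A_def)
    then obtain r where r: "r = \<bar>snd z - t0\<bar>" "0 < r" by simp
    show thesis
    proof (rule that[of "min d (r / 2)"])
      fix x t assume x: "x \<in> cball x0 \<rho>" and t: "\<bar>t - t0\<bar> \<le> min d (r / 2)"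
      then have "(x, t) \<in> cball x0 \<rho> \<times> {t0 - d..t0 + d}" by auto
      moreover have "(x, t) \<notin> A"
      proof
        assume "(x, t) \<in> A"
        from z(2)[OF this] have "r \<le> \<bar>t - t0\<bar>" by (simp add: r(1))
        then show False using t r(2) by simp
      qed
      ultimately show "0 < w x t" by (force simp: A_def)
    qed (use d r(2) in auto)
  qed
  have "\<exists>z\<in>cball x0 \<rho> \<times> {t0 - \<delta>..t0 + \<delta>}. \<forall>z'\<in>cball x0 \<rho> \<times> {t0 - \<delta>..t0 + \<delta>}.
      (case z of (x, t) \<Rightarrow> w x t) \<le> (case z' of (x, t) \<Rightarrow> w x t)"
    by (rule continuous_attains_inf)
       (use \<delta> \<rho> in \<open>auto intro!: compact_Times continuous_on_subset[OF cont]\<close>)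
  then obtain x2 t2 where m: "x2 \<in> cball x0 \<rho>" "t2 \<in> {t0 - \<delta>..t0 + \<delta>}"
    "\<And>x t. x \<in> cball x0 \<rho> \<Longrightarrow> t \<in> {t0 - \<delta>..t0 + \<delta>} \<Longrightarrow> w x2 t2 \<le> w x t" by force
  show thesis
  proof (rule that[of \<delta> "w x2 t2"])
    show "0 < w x2 t2" using \<delta>(3)[OF m(1)] m(2) by auto
    show "w x2 t2 \<le> w x t" if "dist x0 x \<le> \<rho>" "\<bar>t - t0\<bar> \<le> \<delta>" for x t
      using m(3)[of x t] that by (auto simp: abs_le_iff)
  qed (use \<delta> d in auto)
qed

text \<open>If the value at \<open>(x0, t0)\<close> were below \<open>v\<close>, then
  \<open>u \<theta>\<close> minus a rounded cone with apex value \<open>v\<close> would have a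
  negative minimum over a small cylinder. It cannot lie on the boundary, where the cone is
  nonpositive and \<open>u \<theta>\<close> positive, and the supersolution inequality excludes the
  interior.\<close>

lemma distance_lower_bound:
  assumes t0: "0 < t0" "t0 < T" and w: "0 < w x0 t0" and v: "v < infdist x0 (zero_level w t0)"
  shows "\<exists>\<theta>>0. v \<le> u \<theta> x0 t0"
proof (cases "0 < v")
  case False
  have "w x0 t0 \<le> u 1 x0 t0" using lower_barrier[of 1 t0 x0] t0 w by simp
  then show ?thesis using False w by (intro exI[of _ 1]) auto
next
  case True
  define \<rho> where "\<rho> = (v + infdist x0 (zero_level w t0)) / 2"
  have \<rho>: "v < \<rho>" "\<rho> < infdist x0 (zero_level w t0)" using v by (auto simp: \<rho>_def)
  \<comment> \<open>Rounding by \<open>\<epsilon>\<close> lowers the apex of the cone to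
    \<open>c * (\<rho> - \<epsilon>)\<close>. The slope \<open>c\<close> makes this equal to
    \<open>v\<close>, and \<open>\<epsilon>\<close> is small enough for
    \<open>c < 1\<close>.\<close>
  define \<epsilon> where "\<epsilon> = (\<rho> - v) / 2"
  have \<epsilon>: "0 < \<epsilon>" "v < \<rho> - \<epsilon>" using \<rho> by (simp_all add: \<epsilon>_def field_simps)
  define c where "c = v / (\<rho> - \<epsilon>)"
  have c: "0 < c" "c < 1" "c * (\<rho> - \<epsilon>) = v" using \<epsilon> True by (auto simp: c_def)
  obtain \<delta> \<eta> where \<delta>: "0 < \<delta>" "\<delta> < t0" "t0 + \<delta> < T" and \<eta>: "0 < \<eta>"
    and w\<eta>: "\<And>x t. dist x0 x \<le> \<rho> \<Longrightarrow> \<bar>t - t0\<bar> \<le> \<delta> \<Longrightarrow> \<eta> \<le> w x t"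
    using w_positive_cylinder[OF t0 w _ \<rho>(2)] True \<rho>(1) by (metis less_imp_le order_less_trans)
  define Q where "Q = cball x0 \<rho> \<times> {t0 - \<delta>..t0 + \<delta>}"
  have Q: "compact Q" "(x0, t0) \<in> Q" using \<rho> True \<delta> by (auto simp: Q_def intro!: compact_Times)
  \<comment> \<open>Gradients of the rounded cone have length at most \<open>c < 1\<close>, so
    \<open>h\<close> is bounded below on them by the positive number \<open>h p0\<close>.\<close>
  have "\<exists>p\<in>cball 0 c. \<forall>q\<in>cball 0 c. h p \<le> h q"
    by (rule continuous_attains_inf) (use c in \<open>auto intro: continuous_on_subset[OF h_cont]\<close>)
  then obtain p0 where p0: "norm p0 \<le> c" "\<And>q. norm q \<le> c \<Longrightarrow> h p0 \<le> h q" by auto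
  have hp0: "0 < h p0" using p0(1) c by (intro h_pos) auto
  have "continuous_on (cball x0 \<rho> \<times> {t0 - \<delta>..t0 + \<delta>} \<times> cball 0 1) (\<lambda>(x, t, p). H x t p)"
    by (rule continuous_on_subset[OF cont]) (use \<delta> in auto)
  from continuous_on_minus[OF this]
  have "\<exists>z\<in>cball x0 \<rho> \<times> {t0 - \<delta>..t0 + \<delta>} \<times> cball 0 1. \<forall>z'\<in>cball x0 \<rho> \<times> {t0 - \<delta>..t0 + \<delta>} \<times> cball 0 1.
      (case z' of (x, t, p) \<Rightarrow> - H x t p) \<le> (case z of (x, t, p) \<Rightarrow> - H x t p)"
    by (intro continuous_attains_sup)
       (use \<rho> True \<delta> in \<open>auto intro!: compact_Times simp: case_prod_beta\<close>)
  then obtain z where z: "\<And>z'. z' \<in> cball x0 \<rho> \<times> {t0 - \<delta>..t0 + \<delta>} \<times> cball 0 1 \<Longrightarrow>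
      (case z' of (x, t, p) \<Rightarrow> - H x t p) \<le> (case z of (x, t, p) \<Rightarrow> - H x t p)" by blast
  define C1 where "C1 = (case z of (x, t, p) \<Rightarrow> - H x t p)"
  have C1: "- H x t p \<le> C1" if "x \<in> cball x0 \<rho>" "t \<in> {t0 - \<delta>..t0 + \<delta>}" "norm p \<le> 1" for x t p
    using z[of "(x, t, p)"] that by (simp add: C1_def)
  \<comment> \<open>At times \<open>t0 - \<delta>\<close> and \<open>t0 + \<delta>\<close> the
    quadratic term lowers the barrier by \<open>\<rho>\<close>, which makes it nonpositive
    there.\<close>
  define k where "k = \<rho> / \<delta>\<^sup>2"
  have k: "0 < k" "k * \<delta>\<^sup>2 = \<rho>" using \<rho> True \<delta> by (auto simp: k_def)
  \<comment> \<open>The reaction at value \<open>\<eta>\<close> then exceeds by 1 the sum of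
    \<open>2 * k * \<delta>\<close>, which bounds the time derivative, and
    \<open>\<bar>C1\<bar>\<close>, which bounds the contribution of \<open>- H\<close>.\<close>
  define \<theta> where "\<theta> = (2 * k * \<delta> + \<bar>C1\<bar> + 1) / (\<beta> \<eta> * h p0)"
  have \<beta>\<eta>: "0 < \<beta> \<eta>" using \<eta> by (rule beta_pos)
  have "0 < 2 * k * \<delta> + \<bar>C1\<bar> + 1" using k \<delta> by (simp add: add_nonneg_pos)
  then have \<theta>: "0 < \<theta>" "\<theta> * (\<beta> \<eta> * h p0) = 2 * k * \<delta> + \<bar>C1\<bar> + 1"
    using \<beta>\<eta> hp0 by (auto simp: \<theta>_def)
  have u\<eta>: "\<eta> \<le> u \<theta> x t" if "(x, t) \<in> Q" for x t
  proof -
    have "\<eta> \<le> w x t" using that by (intro w\<eta>) (auto simp: Q_def)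
    then show ?thesis using lower_barrier[OF \<theta>(1), of t x] \<eta> that \<delta> by (force simp: Q_def)
  qed
  have "v \<le> u \<theta> x0 t0"
  proof (rule ccontr)
    assume less: "\<not> v \<le> u \<theta> x0 t0"
    define f where "f x t = u \<theta> x t - c * \<rho> + c * sqrt (\<epsilon>\<^sup>2 + (norm (x - x0))\<^sup>2) + k * (t - t0)\<^sup>2" for x t
    have "continuous_on Q (\<lambda>(x, t). u \<theta> x t)"
      by (rule continuous_on_subset[OF u_cont[OF \<theta>(1)]]) (use \<delta> in \<open>auto simp: Q_def\<close>)
    then have "continuous_on Q (\<lambda>z. f (fst z) (snd z))"
      unfolding f_def case_prod_beta by (intro continuous_intros)
    then have "\<exists>z\<in>Q. \<forall>z'\<in>Q. f (fst z) (snd z) \<le> f (fst z') (snd z')"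
      using Q by (intro continuous_attains_inf) auto
    then obtain x1 t1 where z1: "(x1, t1) \<in> Q" "\<And>x t. (x, t) \<in> Q \<Longrightarrow> f x1 t1 \<le> f x t" by force
    have "f x0 t0 = u \<theta> x0 t0 - c * (\<rho> - \<epsilon>)" using \<epsilon> by (simp add: f_def algebra_simps)
    then have neg: "f x1 t1 < 0" using z1(2)[OF Q(2)] less c by simp
    have u1: "0 < u \<theta> x1 t1" using u\<eta>[OF z1(1)] \<eta> by simp
    have sq: "norm (x1 - x0) \<le> sqrt (\<epsilon>\<^sup>2 + (norm (x1 - x0))\<^sup>2)" by (intro real_le_rsqrt) simp
    have x1: "norm (x1 - x0) < \<rho>"
    proof (rule ccontr)
      assume "\<not> ?thesis"
      then have "\<rho> \<le> sqrt (\<epsilon>\<^sup>2 + (norm (x1 - x0))\<^sup>2)" using sq by linarith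
      then have "c * \<rho> \<le> c * sqrt (\<epsilon>\<^sup>2 + (norm (x1 - x0))\<^sup>2)" using c by (intro mult_left_mono) auto
      moreover have "0 \<le> k * (t1 - t0)\<^sup>2" using k by simp
      ultimately show False using neg u1 by (simp add: f_def)
    qed
    have "\<bar>t1 - t0\<bar> \<noteq> \<delta>"
    proof
      assume "\<bar>t1 - t0\<bar> = \<delta>"
      then have "(t1 - t0)\<^sup>2 = \<delta>\<^sup>2" by (metis power2_abs)
      moreover have "c * \<rho> \<le> \<rho>" using c \<rho> True by (simp add: mult_le_cancel_right1)
      moreover have "0 \<le> c * sqrt (\<epsilon>\<^sup>2 + (norm (x1 - x0))\<^sup>2)" using c by simp
      ultimately show False using neg u1 k by (simp add: f_def)
    qed
    then have t1: "\<bar>t1 - t0\<bar> < \<delta>" using z1(1) by (auto simp: Q_def)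
    define q where "q = (c / sqrt (\<epsilon>\<^sup>2 + (norm (x1 - x0))\<^sup>2)) *\<^sub>R (x1 - x0)"
    have opn: "open (ball x0 \<rho> \<times> {t0 - \<delta><..<t0 + \<delta>})" by (intro open_Times) auto
    define k0 where "k0 = - c * \<rho> - f x1 t1"
    have "snd ((\<lambda>(x, t). ((2 * 0 * exp (0 * t)) *\<^sub>R (x - x0) + (c / sqrt (\<epsilon>\<^sup>2 + (norm (x - x0))\<^sup>2)) *\<^sub>R (x - x0),
         0 * exp (0 * t) * (0 + 0 * (norm (x - x0))\<^sup>2) + 0 / (T - t)\<^sup>2 + 2 * k * (t - t0))) (x1, t1))
        \<le> - H x1 t1 (- fst ((\<lambda>(x, t). ((2 * 0 * exp (0 * t)) *\<^sub>R (x - x0) + (c / sqrt (\<epsilon>\<^sup>2 + (norm (x - x0))\<^sup>2)) *\<^sub>R (x - x0),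
         0 * exp (0 * t) * (0 + 0 * (norm (x - x0))\<^sup>2) + 0 / (T - t)\<^sup>2 + 2 * k * (t - t0))) (x1, t1)))
          - \<theta> * \<beta> (- (- u \<theta> x1 t1)) * h (- fst ((\<lambda>(x, t). ((2 * 0 * exp (0 * t)) *\<^sub>R (x - x0) + (c / sqrt (\<epsilon>\<^sup>2 + (norm (x - x0))\<^sup>2)) *\<^sub>R (x - x0),
         0 * exp (0 * t) * (0 + 0 * (norm (x - x0))\<^sup>2) + 0 / (T - t)\<^sup>2 + 2 * k * (t - t0))) (x1, t1)))"
    proof (rule csub_testD[OF u_super[OF \<theta>(1)] C1_with_gradient_penalty[where ?k0.0 = k0] opn])
      fix x t assume "(x, t) \<in> ball x0 \<rho> \<times> {t0 - \<delta><..<t0 + \<delta>}"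
      then have "f x1 t1 \<le> f x t" by (intro z1(2)) (auto simp: Q_def)
      then show "- u \<theta> x t \<le> (case (x, t) of (x, t) \<Rightarrow> exp (0 * t) * (0 + 0 * (norm (x - x0))\<^sup>2)
          + c * sqrt (\<epsilon>\<^sup>2 + (norm (x - x0))\<^sup>2) + 0 / (T - t) + k * (t - t0)\<^sup>2 + k0)"
        by (simp add: f_def k0_def)
    qed (use x1 t1 \<epsilon> \<delta> in \<open>auto simp: f_def k0_def dist_norm norm_minus_commute\<close>)
    then have main: "2 * k * (t1 - t0) \<le> - H x1 t1 (- q) - \<theta> * \<beta> (u \<theta> x1 t1) * h (- q)"
      by (simp add: q_def)
    have S: "0 < sqrt (\<epsilon>\<^sup>2 + (norm (x1 - x0))\<^sup>2)" using \<epsilon> by (simp add: add_pos_nonneg)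
    have "norm q = c * (norm (x1 - x0) / sqrt (\<epsilon>\<^sup>2 + (norm (x1 - x0))\<^sup>2))" using c S by (simp add: q_def)
    also have "\<dots> \<le> c * 1" using sq S c by (intro mult_left_mono) (simp_all add: divide_le_eq_1)
    finally have nq: "norm (- q) \<le> c" by simp
    have "- H x1 t1 (- q) \<le> C1" using z1(1) nq c by (intro C1) (auto simp: Q_def)
    moreover have "\<theta> * (\<beta> \<eta> * h p0) \<le> \<theta> * (\<beta> (u \<theta> x1 t1) * h (- q))"
      using monoD[OF beta_mono u\<eta>[OF z1(1)]] p0(2)[OF nq] \<theta> \<beta>\<eta> hp0
      by (intro mult_left_mono mult_mono) auto
    moreover have "2 * k * (- \<delta>) \<le> 2 * k * (t1 - t0)" using k t1 by (intro mult_left_mono) auto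
    ultimately show False using main \<theta>(2) abs_ge_self[of C1] by (simp add: algebra_simps)
  qed
  then show ?thesis using \<theta>(1) by blast
qed

text \<open>Finiteness is \<open>cone_bound\<close> with its vertex at any point of the zero level.
  The lower bound takes \<open>v\<close> just below the distance.\<close>

lemma positive_region_bounds:
  assumes t: "0 < t" "t < T" and ne: "zero_level w t \<noteq> {}" and x: "0 < w x t"
  shows "ereal (infdist x (zero_level w t)) \<le> (SUP \<theta>\<in>{0<..}. ereal (u \<theta> x t))"
    and "(SUP \<theta>\<in>{0<..}. ereal (u \<theta> x t)) < \<infinity>"
proof -
  obtain y where "w y t = 0" using ne by (auto simp: zero_level_def)
  have "(SUP \<theta>\<in>{0<..}. ereal (u \<theta> x t)) \<le> ereal (exp (L1 * t) * (max 2 (L + 1) * norm (x - y)))"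
    using cone_bound[OF _ less_imp_le[OF t(1)] t(2) \<open>w y t = 0\<close>] by (intro SUP_least) simp
  also have "\<dots> < \<infinity>" by simp
  finally show "(SUP \<theta>\<in>{0<..}. ereal (u \<theta> x t)) < \<infinity>" .
  show "ereal (infdist x (zero_level w t)) \<le> (SUP \<theta>\<in>{0<..}. ereal (u \<theta> x t))"
  proof (rule ereal_le_epsilon2)
    fix e :: real assume "0 < e"
    then obtain \<theta> where \<theta>: "0 < \<theta>" "infdist x (zero_level w t) - e \<le> u \<theta> x t"
      using distance_lower_bound[OF t x, of "infdist x (zero_level w t) - e"] by auto
    have "ereal (infdist x (zero_level w t)) \<le> ereal (u \<theta> x t) + ereal e" using \<theta>(2) by simp
    also have "\<dots> \<le> (SUP \<theta>\<in>{0<..}. ereal (u \<theta> x t)) + ereal e"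
      using \<theta>(1) by (intro add_right_mono SUP_upper) auto
    finally show "ereal (infdist x (zero_level w t)) \<le> (SUP \<theta>\<in>{0<..}. ereal (u \<theta> x t)) + ereal e" .
  qed
qed

end

subsection \<open>The distance bounds\<close>

lemma viscosity_solution_ivpD:
  assumes "viscosity_solution_ivp T F u0 u" "0 < T"
  shows "csub T F u" "csub T (\<lambda>x t r p. - F x t (- r) (- p)) (\<lambda>x t. - u x t)"
    "continuous_on (UNIV \<times> {0..<T}) (\<lambda>(x, t). u x t)" "u x 0 = u0 x"
    "\<exists>D. \<forall>x t. 0 \<le> t \<longrightarrow> t < T \<longrightarrow> \<bar>u x t - u0 x\<bar> \<le> D"
proof -
  note sol = assms(1)[unfolded viscosity_solution_ivp_def viscosity_solution_def]
  show cont: "continuous_on (UNIV \<times> {0..<T}) (\<lambda>(x, t). u x t)" and "u x 0 = u0 x" using sol by auto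
  show "csub T F u" using sol csub_of_viscosity_subsolution[OF _ cont] by blast
  show "csub T (\<lambda>x t r p. - F x t (- r) (- p)) (\<lambda>x t. - u x t)"
    using sol csub_of_viscosity_supersolution[OF _ cont] by blast
  obtain K where K: "0 < K" "\<And>x t. t \<in> {0..<T} \<Longrightarrow> u0 x - K * t \<le> u x t \<and> u x t \<le> u0 x + K * t"
    using sol by blast
  have "\<bar>u x t - u0 x\<bar> \<le> K * T" if "0 \<le> t" "t < T" for x t
  proof -
    have "K * t \<le> K * T" using K that by (intro mult_left_mono) auto
    then show ?thesis using K(2)[of t x] that by (auto simp: abs_le_iff)
  qed
  then show "\<exists>D. \<forall>x t. 0 \<le> t \<longrightarrow> t < T \<longrightarrow> \<bar>u x t - u0 x\<bar> \<le> D" by blast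
qed

lemma continuous_on_modulus:
  fixes h :: "'a::real_normed_vector \<Rightarrow> real"
  assumes "modulus \<omega>" "\<And>p q. \<bar>h p - h q\<bar> \<le> \<omega> (norm (p - q))"
  shows "continuous_on UNIV h"
proof -
  have "\<exists>d>0. \<forall>q. dist q p < d \<longrightarrow> dist (h q) (h p) < e" if e: "0 < e" for p e
  proof -
    have "\<forall>\<^sub>F r in at_right 0. \<omega> r < e"
      using assms(1) e by (intro order_tendstoD(2)[of \<omega> 0]) (auto simp: modulus_def)
    then obtain b where b: "0 < b" "\<And>r. 0 < r \<Longrightarrow> r < b \<Longrightarrow> \<omega> r < e"
      unfolding eventually_at_right_field by blast
    have "\<bar>h q - h p\<bar> < e" if "norm (q - p) < b" for q
    proof (cases "q = p")
      case False
      then show ?thesis using b(2)[of "norm (q - p)"] that assms(2)[of q p] by simp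
    qed (use e in simp)
    then show ?thesis using b(1) by (auto simp: dist_norm)
  qed
  then show ?thesis unfolding continuous_on_iff by blast
qed

theorem theorem2p2:
  fixes T :: real
    and u0 :: "real ^ 'n \<Rightarrow> real"
    and H1 :: "real ^ 'n \<Rightarrow> real \<Rightarrow> real ^ 'n \<Rightarrow> real"
    and \<beta> :: "real \<Rightarrow> real"
    and h :: "real ^ 'n \<Rightarrow> real"
    and w :: "real ^ 'n \<Rightarrow> real \<Rightarrow> real"
    and u :: "real \<Rightarrow> real ^ 'n \<Rightarrow> real \<Rightarrow> real"
  assumes T_pos: "T > 0"
    and u0_lipschitz: "\<exists>L. L-lipschitz_on UNIV u0"
    and H1_continuous: "continuous_on (UNIV \<times> {0..T} \<times> UNIV) (\<lambda>(x, t, p). H1 x t p)"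
    and H1_homogeneous:
      "\<forall>l>0. \<forall>x. \<forall>t\<in>{0..T}. \<forall>p. H1 x t (l *\<^sub>R p) = l * H1 x t p"
    and H1_lipschitz_x:
      "\<exists>L1>0. \<forall>x y. \<forall>t\<in>{0..T}. \<forall>p. norm p = 1 \<longrightarrow> \<bar>H1 x t p - H1 y t p\<bar> \<le> L1 * norm (x - y)"
    and H1_lipschitz_p:
      "\<exists>L2>0. \<forall>x p q. \<forall>t\<in>{0..T}. \<bar>H1 x t p - H1 x t q\<bar> \<le> L2 * norm (p - q)"
    and H1_bounded:
      "bdd_above {\<bar>H1 x t p\<bar> | x t p. t \<in> {0..T} \<and> norm p = 1}"
    and \<beta>_lipschitz: "\<exists>L. L-lipschitz_on UNIV \<beta>"
    and \<beta>_mono: "mono \<beta>"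
    and \<beta>_bounded: "bounded (range \<beta>)"
    and \<beta>_zero: "\<beta> 0 = 0"
    and \<beta>_pos: "\<forall>r>0. \<beta> r > 0"
    and \<beta>_neg: "\<forall>r<0. \<beta> r < 0"
    and h_modulus: "\<exists>\<omega>. modulus \<omega> \<and> (\<forall>p q. \<bar>h p - h q\<bar> \<le> \<omega> (norm (p - q)))"
    and h_pos: "\<forall>p. norm p < 1 \<longrightarrow> h p > 0"
    and h_zero: "\<forall>p. norm p \<ge> 1 \<longrightarrow> h p = 0"
    and w_solution: "viscosity_solution_ivp T (\<lambda>x t r p. H1 x t p) u0 w"
    and zero_level_nonempty: "\<forall>t\<in>{0..<T}. zero_level w t \<noteq> {}"
    and u_solution:
      "\<forall>\<theta>>0. viscosity_solution_ivp T (\<lambda>x t r p. H1 x t p + \<theta> * \<beta> r * h p) u0 (u \<theta>)"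
  shows "\<forall>t\<in>{0<..<T}.
      (\<forall>x\<in>pos_region w t.
         ereal (signed_distance w x t) \<le> (SUP \<theta>\<in>{0<..}. ereal (u \<theta> x t)) \<and>
         (SUP \<theta>\<in>{0<..}. ereal (u \<theta> x t)) < \<infinity>) \<and>
      (\<forall>x\<in>neg_region w t.
         ereal (signed_distance w x t) \<ge> (INF \<theta>\<in>{0<..}. ereal (u \<theta> x t)) \<and>
         (INF \<theta>\<in>{0<..}. ereal (u \<theta> x t)) > - \<infinity>)"
proof -
  obtain L where L: "L-lipschitz_on UNIV u0" using u0_lipschitz by blast
  obtain L1 where L1: "0 < L1"
    "\<And>x y t p. t \<in> {0..T} \<Longrightarrow> norm p = 1 \<Longrightarrow> \<bar>H1 x t p - H1 y t p\<bar> \<le> L1 * norm (x - y)"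
    using H1_lipschitz_x by metis
  obtain L2 where L2: "0 < L2" "\<And>x p q t. t \<in> {0..T} \<Longrightarrow> \<bar>H1 x t p - H1 x t q\<bar> \<le> L2 * norm (p - q)"
    using H1_lipschitz_p by metis
  obtain B where B: "B-lipschitz_on UNIV \<beta>" using \<beta>_lipschitz by blast
  obtain \<omega> where \<omega>: "modulus \<omega>" "\<And>p q. \<bar>h p - h q\<bar> \<le> \<omega> (norm (p - q))" using h_modulus by blast
  have hom: "H1 x t (l *\<^sub>R p) = l * H1 x t p" if "0 < l" "0 \<le> t" "t \<le> T" for l x t p
    using H1_homogeneous that by simp
  \<comment> \<open>Homogeneity reduces \<open>p\<close> to its direction; at \<open>p = 0\<close>
    it gives \<open>H1 x t 0 = 2 * H1 x t 0\<close>, so the value is 0.\<close>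
  have lip_x: "\<bar>H1 x t p - H1 y t p\<bar> \<le> L1 * norm (x - y) * norm p" if t: "0 \<le> t" "t \<le> T" for x y t p
  proof (cases "p = 0")
    case True
    have "H1 x t 0 = 0" for x using hom[of 2 t x 0] t by simp
    then show ?thesis using True by simp
  next
    case False
    have "H1 x t p = norm p * H1 x t (sgn p)" for x
      using hom[of "norm p" t x "sgn p"] False t by (simp add: sgn_div_norm)
    then have "\<bar>H1 x t p - H1 y t p\<bar> = norm p * \<bar>H1 x t (sgn p) - H1 y t (sgn p)\<bar>"
      by (simp add: abs_mult flip: right_diff_distrib)
    also have "\<dots> \<le> norm p * (L1 * norm (x - y))"
      using L1(2)[of t "sgn p" x y] False t by (intro mult_left_mono) (auto simp: norm_sgn)
    finally show ?thesis by (simp add: mult_ac)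
  qed
  note wD = viscosity_solution_ivpD[OF w_solution T_pos]
  obtain C where C: "\<And>x t. 0 \<le> t \<Longrightarrow> t < T \<Longrightarrow> \<bar>w x t - u0 x\<bar> \<le> C" using wD(5) by blast
  have uD: "viscosity_solution_ivp T (\<lambda>x t r p. H1 x t p + \<theta> * \<beta> r * h p) u0 (u \<theta>)" if "0 < \<theta>" for \<theta>
    using u_solution that by blast
  have super: "csub T (\<lambda>x t r p. - H1 x t (- p) - \<theta> * \<beta> (- r) * h (- p)) (\<lambda>x t. - u \<theta> x t)"
    if "0 < \<theta>" for \<theta>
    using viscosity_solution_ivpD(2)[OF uD[OF that] T_pos] by simp
  interpret level_set_approximation T H1 L1 L2 \<beta> h u0 w u B L C
  proof
    show "0 \<le> B" "0 \<le> L" using B L by (auto dest: lipschitz_on_nonneg)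
    show "continuous_on UNIV \<beta>" using B by (rule lipschitz_on_continuous_on)
    show "\<bar>\<beta> r\<bar> \<le> B * \<bar>r\<bar>" for r using lipschitz_onD[OF B, of r 0] \<beta>_zero by (simp add: dist_norm)
    show "\<bar>u0 x - u0 y\<bar> \<le> L * norm (x - y)" for x y using lipschitz_onD[OF L, of x y] by (simp add: dist_norm)
    show "continuous_on UNIV h" using \<omega> by (rule continuous_on_modulus)
    show "mono \<beta>" by (rule \<beta>_mono)
    show "csub T (\<lambda>x t r p. H1 x t p) w" by (rule wD(1))
    show "csub T (\<lambda>x t r p. - H1 x t (- p)) (\<lambda>x t. - w x t)" by (rule wD(2))
    show "continuous_on (UNIV \<times> {0..<T}) (\<lambda>(x, t). w x t)" by (rule wD(3))
    show "w x 0 = u0 x" for x by (rule wD(4))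
    show "csub T (\<lambda>x t r p. H1 x t p + \<theta> * \<beta> r * h p) (u \<theta>)" if "0 < \<theta>" for \<theta>
      by (rule viscosity_solution_ivpD(1)[OF uD[OF that] T_pos])
    show "continuous_on (UNIV \<times> {0..<T}) (\<lambda>(x, t). u \<theta> x t)" if "0 < \<theta>" for \<theta>
      by (rule viscosity_solution_ivpD(3)[OF uD[OF that] T_pos])
    show "u \<theta> x 0 = u0 x" if "0 < \<theta>" for \<theta> x
      by (rule viscosity_solution_ivpD(4)[OF uD[OF that] T_pos])
    show "\<exists>D. \<forall>x t. 0 \<le> t \<longrightarrow> t < T \<longrightarrow> \<bar>u \<theta> x t - u0 x\<bar> \<le> D" if "0 < \<theta>" for \<theta>
      by (rule viscosity_solution_ivpD(5)[OF uD[OF that] T_pos])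
  qed (use T_pos L1(1) L2 H1_continuous hom lip_x \<beta>_pos \<beta>_neg h_pos h_zero C super in auto)
  interpret r: level_set_approximation T "\<lambda>x t p. - H1 x t (- p)" L1 L2 "\<lambda>r. - \<beta> (- r)" "\<lambda>p. h (- p)"
    "\<lambda>x. - u0 x" "\<lambda>x t. - w x t" "\<lambda>\<theta> x t. - u \<theta> x t" B L C
    by (rule reflected_approximation)
  show ?thesis
  proof (intro ballI conjI)
    fix t x assume t: "t \<in> {0<..<T}" and x: "x \<in> pos_region w t"
    have "signed_distance w x t = infdist x (zero_level w t)" using x by (simp add: signed_distance_def)
    then show "ereal (signed_distance w x t) \<le> (SUP \<theta>\<in>{0<..}. ereal (u \<theta> x t))"
      "(SUP \<theta>\<in>{0<..}. ereal (u \<theta> x t)) < \<infinity>"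
      using positive_region_bounds[of t x] t x zero_level_nonempty by (auto simp: pos_region_def)
  next
    fix t x assume t: "t \<in> {0<..<T}" and x: "x \<in> neg_region w t"
    \<comment> \<open>Reflection keeps the zero level, swaps the two regions and turns suprema into
      negated infima, so the reflected instance settles the negative region.\<close>
    have refl: "zero_level (\<lambda>x t. - w x t) s = zero_level w s" for s by (simp add: zero_level_def)
    have d: "signed_distance w x t = - infdist x (zero_level w t)"
      using x by (auto simp: signed_distance_def neg_region_def pos_region_def zero_level_def)
    have inf: "(SUP \<theta>\<in>{0<..}. ereal (- u \<theta> x t)) = - (INF \<theta>\<in>{0<..}. ereal (u \<theta> x t))"
      by (simp add: ereal_SUP_uminus_eq flip: uminus_ereal.simps)
    have "0 < t" "t < T" "zero_level w t \<noteq> {}" "0 < - w x t"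
      using t x zero_level_nonempty by (auto simp: neg_region_def)
    from r.positive_region_bounds[unfolded refl, OF this]
    have *: "ereal (infdist x (zero_level w t)) \<le> - (INF \<theta>\<in>{0<..}. ereal (u \<theta> x t))"
      "- (INF \<theta>\<in>{0<..}. ereal (u \<theta> x t)) < \<infinity>" unfolding inf .
    show "ereal (signed_distance w x t) \<ge> (INF \<theta>\<in>{0<..}. ereal (u \<theta> x t))"
      using *(1) unfolding d by (metis ereal_minus_le_minus ereal_uminus_uminus uminus_ereal.simps(1))
    show "(INF \<theta>\<in>{0<..}. ereal (u \<theta> x t)) > - \<infinity>"
      using *(2) by (metis ereal_minus_less_minus ereal_uminus_uminus)
  qed
qed

end
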